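(* Let $b\ge 2$ be an integer and let $\mathcal{P}_b\subseteq[0,1)$ be the set of real numbers in $[0,1)$ that are Poisson generic in base $b$. Then $\mathcal{P}_b$ is $\boldsymbol{\Pi}^0_3$-complete.
   Context: Each $x\in[0,1)$ is identified with its base-$b$ expansion $x=\sum_{j\ge1}x_jb^{-j}$, $x_j\in\{0,\dots,b-1\}$, chosen so that $x_j\neq0$ for infinitely many $j$. For real $r>1$, $x\restriction r$ denotes the word $x_1x_2\cdots x_{\lfloor r\rfloor}$. A word $w$ occurs at position $p$ in a word $u$ if $u_p\cdots u_{p+|w|-1}=w$; the number of occurrences counts all such positions (overlaps allowed). For real $\lambda>0$, integers $j\ge0$, $k\ge1$, let $Z^\lambda_{j,k}(x)=b^{-k}\,\big|\{w\in\{0,\dots,b-1\}^k: w \text{ occurs exactly } j \text{ times in } x\restriction(\lambda b^k+k)\}\big|$. $x$ is $\lambda$-Poisson generic in base $b$ if $\lim_{k\to\infty}Z^\lambda_{j,k}(x)=e^{-\lambda}\lambda^j/j!$ for every integer $j\ge0$, and Poisson generic in base $b$ if it is $\lambda$-Poisson generic in base $b$ for every real $\lambda>0$. Borel classes $\boldsymbol{\Sigma}^0_n,\boldsymbol{\Pi}^0_n$ are as usual (open sets are $\boldsymbol\Sigma^0_1$, closed sets $\boldsymbol\Pi^0_1$, $\boldsymbol\Sigma^0_{n+1}$ = countable unions of $\boldsymbol\Pi^0_n$ sets, $\boldsymbol\Pi^0_{n+1}$ = countable intersections of $\boldsymbol\Sigma^0_n$ sets). A set is complete for a class if it belongs to the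 class and every set in the class (in a zero-dimensional Polish space such as $\omega^\omega$) is reducible to it by a continuous map $f$ (i.e. $z\in A\iff f(z)\in\mathcal P_b$). *)

theory Defs
  imports "HOL-Analysis.Analysis"
begin

text \<open>Levels start at 1: no rule derives a set at level 0.\<close>

inductive Sigma0 :: "'a topology \<Rightarrow> nat \<Rightarrow> 'a set \<Rightarrow> bool"
  and Pi0 :: "'a topology \<Rightarrow> nat \<Rightarrow> 'a set \<Rightarrow> bool"
  for X :: "'a topology"
where
  Sigma0_open: "openin X U \<Longrightarrow> Sigma0 X 1 U"
| Pi0_closed: "closedin X C \<Longrightarrow> Pi0 X 1 C"
| Sigma0_Union: "(\<And>i::nat. Pi0 X n (F i)) \<Longrightarrow> Sigma0 X (Suc n) (\<Union>i. F i)"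
| Pi0_Inter: "(\<And>i::nat. Sigma0 X n (F i)) \<Longrightarrow> Pi0 X (Suc n) (\<Inter>i. F i)"

definition Polish_space :: "'a topology \<Rightarrow> bool" where
  "Polish_space X \<longleftrightarrow> completely_metrizable_space X \<and> separable_space X"

definition continuously_reducible :: "'z topology \<Rightarrow> 'z set \<Rightarrow> 'a topology \<Rightarrow> 'a set \<Rightarrow> bool" where
  "continuously_reducible Z A Y B \<longleftrightarrow>
     (\<exists>f. continuous_map Z Y f \<and> (\<forall>z\<in>topspace Z. z \<in> A \<longleftrightarrow> f z \<in> B))"

text \<open>The type argument is the carrier type of the zero-dimensional Polish spaces whose
  sets have to be reduced to \<open>B\<close>; a theorem in which it is a free type variable covers all of
  them, in particular Baire space on \<^typ>\<open>nat \<Rightarrow> nat\<close>. A zero-dimensional space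
  is one with a base of clopen sets, which is what \<^term>\<open>Z dim_le 0\<close> expresses.\<close>

definition Pi0_complete :: "'z itself \<Rightarrow> nat \<Rightarrow> 'a topology \<Rightarrow> 'a set \<Rightarrow> bool" where
  "Pi0_complete (_ :: 'z itself) n Y B \<longleftrightarrow>
     Pi0 Y n B \<and>
     (\<forall>(Z :: 'z topology) A.
        Polish_space Z \<and> Z dim_le 0 \<and> Pi0 Z n A \<longrightarrow> continuously_reducible Z A Y B)"

text \<open>Digit sequences and words are indexed from 0: \<open>d j\<close> is the digit with weight
  $b^{-(j+1)}$. Since infinitely many digits must be nonzero, every \<open>x\<close> in $(0,1)$ has exactly
  one expansion, while \<open>x = 0\<close> has none.\<close>

definition is_expansion :: "nat \<Rightarrow> (nat \<Rightarrow> nat) \<Rightarrow> real \<Rightarrow> bool" where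
  "is_expansion b d x \<longleftrightarrow>
     (\<forall>j. d j < b) \<and> infinite {j. d j \<noteq> 0} \<and>
     (\<lambda>j. real (d j) / real b ^ Suc j) sums x"

definition restrict_word :: "(nat \<Rightarrow> nat) \<Rightarrow> real \<Rightarrow> nat list" where
  "restrict_word d r = map d [0..<nat \<lfloor>r\<rfloor>]"

definition occurs_at :: "nat list \<Rightarrow> nat \<Rightarrow> nat list \<Rightarrow> bool" where
  "occurs_at w p u \<longleftrightarrow> p + length w \<le> length u \<and> take (length w) (drop p u) = w"

definition occurrences :: "nat list \<Rightarrow> nat list \<Rightarrow> nat" where
  "occurrences w u = card {p. occurs_at w p u}"

definition Z_freq :: "nat \<Rightarrow> real \<Rightarrow> nat \<Rightarrow> nat \<Rightarrow> (nat \<Rightarrow> nat) \<Rightarrow> real" where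
  "Z_freq b l j k d =
     real (card {w. length w = k \<and> set w \<subseteq> {..<b} \<and>
                    occurrences w (restrict_word d (l * real b ^ k + real k)) = j}) / real b ^ k"

definition lambda_Poisson_generic :: "nat \<Rightarrow> real \<Rightarrow> (nat \<Rightarrow> nat) \<Rightarrow> bool" where
  "lambda_Poisson_generic b l d \<longleftrightarrow>
     (\<forall>j. (\<lambda>k. Z_freq b l j k d) \<longlonglongrightarrow> exp (- l) * l ^ j / fact j)"

definition Poisson_generic :: "nat \<Rightarrow> (nat \<Rightarrow> nat) \<Rightarrow> bool" where
  "Poisson_generic b d \<longleftrightarrow> (\<forall>l>0. lambda_Poisson_generic b l d)"

definition Poisson_generic_numbers :: "nat \<Rightarrow> real set" where
  "Poisson_generic_numbers b =
     {x. 0 \<le> x \<and> x < 1 \<and> (\<exists>d. is_expansion b d x \<and> Poisson_generic b d)}"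

end

theory Submission
  imports Defs "HOL-Real_Asymp.Real_Asymp"
begin

text \<open>
  Poisson generic sequences exist: let \<open>q\<^sub>j(m)\<close> be the probability that a uniformly random word
  of length \<open>k\<close> occurs exactly \<open>j\<close> times in an independent uniformly random word of length \<open>m\<close>.
  Adding a letter changes \<open>q\<^sub>j\<close> by \<open>h (q\<^sub>j\<^sub>-\<^sub>1 - q\<^sub>j)\<close> with \<open>h = b\<^sup>-\<^sup>k\<close>, up to an error of order
  \<open>k h\<^sup>2\<close> caused by overlapping occurrences, so \<open>q\<^sub>j\<close> follows the Euler scheme of the differential
  equation of the Poisson weights. Changing one letter changes the observed frequency by at most
  \<open>2 k h\<close>, which gives concentration with summable failure probabilities.

  For the lower bound, write a \<open>\<Pi>\<^sup>0\<^sub>3\<close> set as \<open>{z. \<alpha>\<^sub>z \<longlonglongrightarrow> \<infinity>}\<close> with \<open>\<alpha>\<^sub>z :: nat \<Rightarrow> nat\<close> depending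
  continuously on \<open>z\<close>, and erase the digits of a Poisson generic sequence on a fraction
  \<open>1 / (\<alpha>\<^sub>z s + 2)\<close> of the positions after \<open>b\<^sup>s\<close>. If \<open>\<alpha>\<^sub>z \<longlonglongrightarrow> \<infinity>\<close>, this is negligible at every scale; if
  \<open>\<alpha>\<^sub>z\<close> takes the value \<open>i\<close> infinitely often, the frequencies for \<open>\<lambda> = 1\<close> and
  \<open>\<lambda> = 1 + 1 / (i + 2)\<close> agree asymptotically along these scales, which contradicts genericity.

  For the upper bound, each condition on the first digits defines a set that is closed up to
  \<open>b\<close>-adic rationals, and no \<open>b\<close>-adic rational is Poisson generic.
\<close>

section \<open>Averages over words\<close>

locale base =
  fixes b :: nat
  assumes b2: "2 \<le> b"
begin

lemma b_pow_pos: "0 < real b ^ k"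
  using b2 by simp

definition words :: "nat \<Rightarrow> nat list set" where
  "words n = {u. length u = n \<and> set u \<subseteq> {..<b}}"

text \<open>Probability is done with finite averages: the probability of an event is the mean of its
  indicator \<open>of_bool\<close>, and no measure on infinite sequences is needed.\<close>

definition expect :: "nat \<Rightarrow> (nat list \<Rightarrow> real) \<Rightarrow> real" where
  "expect n f = (\<Sum>u\<in>words n. f u) / real b ^ n"

lemma words_length: "u \<in> words n \<Longrightarrow> length u = n"
  by (simp add: words_def)

lemma finite_words [simp]: "finite (words n)"
  using finite_lists_length_eq[of "{..<b}" n] by (simp add: words_def conj_commute)

lemma card_words: "card (words n) = b ^ n"
  using card_lists_length_eq[of "{..<b}" n] by (simp add: words_def conj_commute)

lemma append_in_words: "u \<in> words m \<Longrightarrow> v \<in> words n \<Longrightarrow> u @ v \<in> words (m + n)"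
  by (auto simp: words_def)

lemma take_in_words: "u \<in> words n \<Longrightarrow> m \<le> n \<Longrightarrow> take m u \<in> words m"
  by (auto simp: words_def dest: in_set_takeD)

lemma expect_cong:
  assumes "\<And>u. u \<in> words n \<Longrightarrow> f u = g u"
  shows "expect n f = expect n g"
  using assms by (simp add: expect_def)

lemma expect_mono:
  assumes "\<And>u. u \<in> words n \<Longrightarrow> f u \<le> g u"
  shows "expect n f \<le> expect n g"
  unfolding expect_def by (intro divide_right_mono sum_mono assms) auto

lemma expect_const [simp]: "expect n (\<lambda>_. c) = c"
  using b2 by (simp add: expect_def card_words)

lemma expect_add: "expect n (\<lambda>u. f u + g u) = expect n f + expect n g"
  by (simp add: expect_def sum.distrib add_divide_distrib)

lemma expect_diff: "expect n (\<lambda>u. f u - g u) = expect n f - expect n g"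
  by (simp add: expect_def sum_subtractf diff_divide_distrib)

lemma expect_cmult: "expect n (\<lambda>u. c * f u) = c * expect n f"
  by (simp add: expect_def sum_distrib_left)

lemma expect_sum: "expect n (\<lambda>u. \<Sum>i\<in>I. f i u) = (\<Sum>i\<in>I. expect n (f i))"
  unfolding expect_def by (subst sum.swap) (simp add: sum_divide_distrib)

lemma expect_abs: "\<bar>expect n f\<bar> \<le> expect n (\<lambda>u. \<bar>f u\<bar>)"
  using b_pow_pos[of n] by (simp add: expect_def divide_right_mono)

lemma expect_abs_le:
  assumes "\<And>u. u \<in> words n \<Longrightarrow> \<bar>f u\<bar> \<le> c"
  shows "\<bar>expect n f\<bar> \<le> c"
  using expect_abs[of n f] expect_mono[of n "\<lambda>u. \<bar>f u\<bar>" "\<lambda>_. c"] assms by simp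

lemma expect_swap:
  "expect m (\<lambda>u. expect n (f u)) = expect n (\<lambda>v. expect m (\<lambda>u. f u v))"
proof -
  have "(\<Sum>u\<in>words m. \<Sum>v\<in>words n. f u v) = (\<Sum>v\<in>words n. \<Sum>u\<in>words m. f u v)"
    by (rule sum.swap)
  then show ?thesis
    by (simp add: expect_def sum_divide_distrib [symmetric] mult.commute)
qed

text \<open>Splitting at position m is a bijection onto pairs of words, so the two parts of a
  uniformly random word are independent and uniform.\<close>

lemma expect_append: "expect (m + n) f = expect m (\<lambda>u. expect n (\<lambda>v. f (u @ v)))"
proof -
  have "(\<Sum>u\<in>words m. \<Sum>v\<in>words n. f (u @ v)) = (\<Sum>(u, v)\<in>words m \<times> words n. f (u @ v))"
    by (simp add: sum.cartesian_product)
  also have "\<dots> = sum f (words (m + n))"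
  proof (rule sum.reindex_bij_witness[where i = "\<lambda>u. (take m u, drop m u)" and j = "\<lambda>(u, v). u @ v"])
    fix u assume "u \<in> words (m + n)"
    then show "(take m u, drop m u) \<in> words m \<times> words n"
      by (auto simp: words_def dest: in_set_takeD in_set_dropD)
  qed (auto simp: words_def)
  finally show ?thesis
    by (simp add: expect_def sum_divide_distrib[symmetric] power_add mult.commute)
qed

lemma expect_take: "expect (m + n) (\<lambda>u. f (take m u)) = expect m f"
  by (simp add: expect_append words_length cong: expect_cong)

lemma expect_of_bool:
  "expect n (\<lambda>u. of_bool (P u)) = real (card {u \<in> words n. P u}) / real b ^ n"
proof -
  have "(\<Sum>u\<in>words n. of_bool (P u)) = real (card {u \<in> words n. P u})"
    by (simp add: of_bool_def sum.If_cases Int_def)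
  then show ?thesis by (simp add: expect_def)
qed

lemma expect_of_bool_le:
  assumes "finite A" "\<And>u. u \<in> words n \<Longrightarrow> P u \<Longrightarrow> u \<in> A"
  shows "expect n (\<lambda>u. of_bool (P u)) \<le> real (card A) / real b ^ n"
proof -
  have "card {u \<in> words n. P u} \<le> card A"
    using assms by (intro card_mono) auto
  then show ?thesis
    unfolding expect_of_bool by (intro divide_right_mono) auto
qed

lemma expect_of_bool_eq:
  assumes "w \<in> words n"
  shows "expect n (\<lambda>u. of_bool (u = w)) = 1 / real b ^ n"
proof -
  have "{u \<in> words n. u = w} = {w}" using assms by auto
  then show ?thesis by (simp add: expect_of_bool)
qed

lemma expect_less_ex:
  assumes "expect n f < c"
  shows "\<exists>u\<in>words n. f u < c"
  using expect_mono[of n "\<lambda>_. c" f] assms by force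

section \<open>Variance and concentration under bounded differences\<close>

text \<open>Conditioning on the first letter splits the variance into the mean of the conditional
  variances and the variance of the conditional means; the latter is at most \<open>c\<^sup>2\<close>.\<close>

lemma variance_bounded_differences:
  assumes "\<And>u v a a'. u @ [a] @ v \<in> words n \<Longrightarrow> u @ [a'] @ v \<in> words n \<Longrightarrow>
      \<bar>f (u @ [a] @ v) - f (u @ [a'] @ v)\<bar> \<le> c"
  shows "expect n (\<lambda>u. (f u - expect n f)\<^sup>2) \<le> n * c\<^sup>2"
  using assms
proof (induction n arbitrary: f)
  case 0
  have "words 0 = {[]}" by (auto simp: words_def)
  then show ?case by (simp add: expect_def)
next
  case (Suc n)
  define g where "g s = expect n (\<lambda>u. f (s @ u))" for s
  have split: "expect (Suc n) F = expect 1 (\<lambda>s. expect n (\<lambda>u. F (s @ u)))" for F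
    using expect_append[of 1 n F] by simp
  have m: "expect (Suc n) f = expect 1 g"
    by (simp only: split g_def[abs_def])
  \<comment> \<open>The conditional means for two first letters differ by at most c, hence each
    differs from their average by at most c.\<close>
  have gd: "\<bar>g s - expect 1 g\<bar> \<le> c" if s: "s \<in> words 1" for s
  proof -
    have "\<bar>g s - g t\<bar> \<le> c" if t: "t \<in> words 1" for t
      unfolding g_def expect_diff[symmetric]
    proof (rule expect_abs_le)
      fix u assume u: "u \<in> words n"
      obtain a a' where st: "s = [a]" "t = [a']"
        using s t by (auto simp: words_def length_Suc_conv)
      show "\<bar>f (s @ u) - f (t @ u)\<bar> \<le> c"
        using Suc.prems[of "[]" a u a'] append_in_words[OF s u] append_in_words[OF t u] st by simp
    qed
    then have "\<bar>expect 1 (\<lambda>t. g s - g t)\<bar> \<le> c" by (rule expect_abs_le)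
    then show ?thesis by (simp add: expect_diff)
  qed
  have step: "expect n (\<lambda>u. (f (s @ u) - expect 1 g)\<^sup>2) \<le> n * c\<^sup>2 + c\<^sup>2" if s: "s \<in> words 1" for s
  proof -
    have eq: "(f (s @ u) - expect 1 g)\<^sup>2 = (f (s @ u) - g s)\<^sup>2 +
        2 * (g s - expect 1 g) * (f (s @ u) - g s) + (g s - expect 1 g)\<^sup>2" for u
      by (simp add: power2_eq_square algebra_simps)
    \<comment> \<open>The cross term vanishes because \<open>f (s @ u) - g s\<close> has mean 0 over
      u.\<close>
    have "expect n (\<lambda>u. (f (s @ u) - expect 1 g)\<^sup>2) =
        expect n (\<lambda>u. (f (s @ u) - g s)\<^sup>2) + (g s - expect 1 g)\<^sup>2"
      unfolding eq by (simp add: expect_add expect_cmult expect_diff g_def)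
    moreover have "expect n (\<lambda>u. (f (s @ u) - g s)\<^sup>2) \<le> n * c\<^sup>2"
      unfolding g_def
    proof (rule Suc.IH)
      fix u v a a' assume "u @ [a] @ v \<in> words n" "u @ [a'] @ v \<in> words n"
      then show "\<bar>f (s @ u @ [a] @ v) - f (s @ u @ [a'] @ v)\<bar> \<le> c"
        using Suc.prems[of "s @ u" a v a'] append_in_words[OF s] by fastforce
    qed
    moreover have "(g s - expect 1 g)\<^sup>2 \<le> c\<^sup>2"
      using gd[OF s] by (metis abs_ge_zero power2_abs power_mono)
    ultimately show ?thesis by simp
  qed
  have "expect (Suc n) (\<lambda>u. (f u - expect (Suc n) f)\<^sup>2) \<le> expect 1 (\<lambda>_. n * c\<^sup>2 + c\<^sup>2)"
    unfolding m split[of "\<lambda>u. (f u - expect 1 g)\<^sup>2"] by (rule expect_mono) (rule step)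
  then show ?case by (simp add: algebra_simps)
qed

lemma chebyshev_bounded_differences:
  assumes "\<And>u v a a'. u @ [a] @ v \<in> words n \<Longrightarrow> u @ [a'] @ v \<in> words n \<Longrightarrow>
      \<bar>f (u @ [a] @ v) - f (u @ [a'] @ v)\<bar> \<le> c"
    and "0 < e"
  shows "expect n (\<lambda>u. of_bool (\<bar>f u - expect n f\<bar> > e)) \<le> n * c\<^sup>2 / e\<^sup>2"
proof -
  have "expect n (\<lambda>u. of_bool (\<bar>f u - expect n f\<bar> > e)) \<le>
      expect n (\<lambda>u. 1 / e\<^sup>2 * (f u - expect n f)\<^sup>2)"
  proof (rule expect_mono)
    fix u
    have "e\<^sup>2 \<le> (f u - expect n f)\<^sup>2" if "\<bar>f u - expect n f\<bar> > e"
      using that \<open>0 < e\<close> by (metis less_eq_real_def power2_abs power_mono)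
    then show "of_bool (\<bar>f u - expect n f\<bar> > e) \<le> 1 / e\<^sup>2 * (f u - expect n f)\<^sup>2"
      using \<open>0 < e\<close> by (auto simp: of_bool_def field_simps)
  qed
  also have "\<dots> = expect n (\<lambda>u. (f u - expect n f)\<^sup>2) / e\<^sup>2"
    by (simp only: expect_cmult) simp
  also have "\<dots> \<le> n * c\<^sup>2 / e\<^sup>2"
    using variance_bounded_differences[of n f c] assms by (intro divide_right_mono) auto
  finally show ?thesis .
qed

end

section \<open>Counting occurrences\<close>

lemma finite_occurs_at: "finite {p. occurs_at w p u}"
  by (rule finite_subset[of _ "{..length u}"]) (auto simp: occurs_at_def)

lemma occurs_at_take: "occurs_at w p (take n u) \<longleftrightarrow> p + length w \<le> n \<and> occurs_at w p u"
proof (cases "p + length w \<le> n")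
  case True
  then have "min (length w) (n - p) = length w" by simp
  then show ?thesis using True by (auto simp: occurs_at_def drop_take take_take)
qed (auto simp: occurs_at_def)

lemma occurrences_cong:
  assumes "\<And>p. occurs_at w p u \<longleftrightarrow> occurs_at w p u'"
  shows "occurrences w u = occurrences w u'"
  using assms by (simp add: occurrences_def)

text \<open>The last letter of u belongs to a single window of length k, the one starting at
  m.\<close>

lemma occurrences_butlast:
  assumes "length u = m + k" "0 < k" "length w = k"
  shows "occurrences w u = occurrences w (butlast u) + of_bool (drop m u = w)"
proof -
  have 1: "occurs_at w p (butlast u) \<longleftrightarrow> p < m \<and> occurs_at w p u" for p
    unfolding butlast_conv_take occurs_at_take using assms by (cases k) auto
  have 2: "occurs_at w m u \<longleftrightarrow> drop m u = w"
    using assms by (simp add: occurs_at_def)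
  have 3: "p \<le> m" if "occurs_at w p u" for p
    using that assms by (simp add: occurs_at_def)
  have "{p. occurs_at w p u} = {p. occurs_at w p (butlast u)} \<union> (if drop m u = w then {m} else {})"
    using 1 2 3 by (auto simp: le_less)
  then show ?thesis
    unfolding occurrences_def using 1 finite_occurs_at[of w "butlast u"] by auto
qed

section \<open>Sensitivity of the frequencies to changes of the long word\<close>

context base
begin

text \<open>This is \<open>Z_freq\<close> as a function of the finite prefix that it reads. Being an
  average over w, it can be exchanged with an average over u.\<close>

definition fraction :: "nat \<Rightarrow> nat \<Rightarrow> nat list \<Rightarrow> real" where
  "fraction k j u = expect k (\<lambda>w. of_bool (occurrences w u = j))"

lemma Z_freq_eq_fraction:
  assumes "0 \<le> l"
  shows "Z_freq b l j k d = fraction k j (map d [0..<nat \<lfloor>l * real b ^ k\<rfloor> + k])"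
proof -
  have "0 \<le> \<lfloor>l * real b ^ k\<rfloor>" using assms by simp
  \<comment> \<open>The integer k leaves the floor, so the prefix has one more window of length k
    than the floor of \<open>l * real b ^ k\<close>.\<close>
  moreover have "\<lfloor>l * real b ^ k + real k\<rfloor> = \<lfloor>l * real b ^ k\<rfloor> + int k" by simp
  ultimately have "nat \<lfloor>l * real b ^ k + real k\<rfloor> = nat \<lfloor>l * real b ^ k\<rfloor> + k"
    by (simp only: nat_add_distrib of_nat_0_le_iff nat_int)
  then show ?thesis
    by (simp add: Z_freq_def restrict_word_def fraction_def expect_of_bool words_def conj_assoc)
qed

text \<open>Only words in A can change their count, and each of them has weight
  \<open>1 / real b ^ k\<close>.\<close>

lemma fraction_diff_le:
  assumes "finite A" "\<And>w. w \<in> words k \<Longrightarrow> w \<notin> A \<Longrightarrow> occurrences w u = occurrences w u'"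
  shows "\<bar>fraction k j u - fraction k j u'\<bar> \<le> real (card A) / real b ^ k"
proof -
  have "\<bar>fraction k j u - fraction k j u'\<bar> \<le>
      expect k (\<lambda>w. \<bar>of_bool (occurrences w u = j) - of_bool (occurrences w u' = j)\<bar>)"
    unfolding fraction_def expect_diff[symmetric] by (rule expect_abs)
  also have "\<dots> \<le> expect k (\<lambda>w. of_bool (w \<in> A))"
    using assms(2) by (intro expect_mono) (auto simp: of_bool_def)
  also have "\<dots> \<le> real (card A) / real b ^ k"
    using assms(1) by (rule expect_of_bool_le)
  finally show ?thesis .
qed

text \<open>A position in D can affect only the two words read there, one in u and one in
  u'.\<close>

lemma fraction_diff_positions:
  assumes "length u = length u'" "finite D"
    and "\<And>p. p \<notin> D \<Longrightarrow> p + k \<le> length u \<Longrightarrow> take k (drop p u) = take k (drop p u')"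
  shows "\<bar>fraction k j u - fraction k j u'\<bar> \<le> 2 * real (card D) / real b ^ k"
proof -
  define A where "A = (\<lambda>p. take k (drop p u)) ` D \<union> (\<lambda>p. take k (drop p u')) ` D"
  have "\<bar>fraction k j u - fraction k j u'\<bar> \<le> real (card A) / real b ^ k"
  proof (rule fraction_diff_le)
    show "finite A" using assms(2) by (simp add: A_def)
    fix w assume w: "w \<in> words k" "w \<notin> A"
    show "occurrences w u = occurrences w u'"
    proof (rule occurrences_cong)
      fix p
      show "occurs_at w p u \<longleftrightarrow> occurs_at w p u'"
        using w assms(1) assms(3)[of p]
        by (cases "p \<in> D") (auto simp: occurs_at_def A_def words_length)
    qed
  qed
  moreover have "card A \<le> card D + card D"
    unfolding A_def by (rule order_trans[OF card_Un_le]) (intro add_mono card_image_le assms)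
  ultimately show ?thesis
    using b_pow_pos[of k] by (auto simp: field_simps intro: order_trans)
qed

text \<open>The bound counts the distinct words read in the new windows rather than the windows. A
  long appended stretch that repeats one word is therefore almost free.\<close>

lemma fraction_diff_append:
  "\<bar>fraction k j u - fraction k j (u @ v)\<bar> \<le>
    real (card ((\<lambda>p. take k (drop p (u @ v))) ` {p. length u < p + k \<and> p + k \<le> length u + length v}))
      / real b ^ k"
proof (rule fraction_diff_le)
  let ?P = "{p. length u < p + k \<and> p + k \<le> length u + length v}"
  have "finite ?P" by (rule finite_subset[of _ "{..length u + length v}"]) auto
  then show "finite ((\<lambda>p. take k (drop p (u @ v))) ` ?P)" by simp
  fix w assume w: "w \<in> words k" "w \<notin> (\<lambda>p. take k (drop p (u @ v))) ` ?P"
  show "occurrences w u = occurrences w (u @ v)"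
  proof (rule occurrences_cong)
    fix p
    have "occurs_at w p u \<longleftrightarrow> p + k \<le> length u \<and> occurs_at w p (u @ v)"
      using occurs_at_take[of w p "length u" "u @ v"] w by (simp add: words_length)
    moreover have "p + k \<le> length u" if "occurs_at w p (u @ v)"
      using w that by (force simp: occurs_at_def words_length not_le)
    ultimately show "occurs_at w p u \<longleftrightarrow> occurs_at w p (u @ v)" by blast
  qed
qed

lemma card_shifted_interval: "card {p. a < p + k \<and> p + k \<le> a + n} \<le> n" for a k n :: nat
proof -
  have "{p. a < p + k \<and> p + k \<le> a + n} \<subseteq> {a + 1 - k..<a + 1 - k + n}" by auto
  from card_mono[OF _ this] show ?thesis by simp
qed

lemma fraction_diff_append_length:
  "\<bar>fraction k j u - fraction k j (u @ v)\<bar> \<le> real (length v) / real b ^ k"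
proof -
  let ?P = "{p. length u < p + k \<and> p + k \<le> length u + length v}"
  have "finite ?P" by (rule finite_subset[of _ "{..length u + length v}"]) auto
  then have "card ((\<lambda>p. take k (drop p (u @ v))) ` ?P) \<le> length v"
    using card_image_le card_shifted_interval order_trans by meson
  then show ?thesis
    using fraction_diff_append[of k j u v] b_pow_pos[of k]
    by (meson divide_right_mono less_imp_le of_nat_le_iff order_trans)
qed

text \<open>A given letter lies in at most k windows of length k.\<close>

lemma fraction_bounded_differences:
  "\<bar>fraction k j (u @ [a] @ v) - fraction k j (u @ [a'] @ v)\<bar> \<le> 2 * real k / real b ^ k"
proof -
  let ?D = "{p. length u < p + k \<and> p + k \<le> length u + k}"
  have fin: "finite ?D" by (rule finite_subset[of _ "{..length u + k}"]) auto
  have "\<bar>fraction k j (u @ [a] @ v) - fraction k j (u @ [a'] @ v)\<bar> \<le> 2 * real (card ?D) / real b ^ k"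
  proof (rule fraction_diff_positions)
    fix p assume "p \<notin> ?D"
    then consider "p + k \<le> length u" | "length u < p" by force
    then show "take k (drop p (u @ [a] @ v)) = take k (drop p (u @ [a'] @ v))"
    proof cases
      case 2
      then obtain i where "p = length u + Suc i" using less_imp_Suc_add by fastforce
      then show ?thesis by simp
    qed simp
  qed (use fin in auto)
  also have "\<dots> \<le> 2 * real k / real b ^ k"
    using card_shifted_interval[of "length u" k k]
    by (intro divide_right_mono) auto
  finally show ?thesis .
qed

section \<open>Means over a random long word\<close>

definition mean_fraction :: "nat \<Rightarrow> nat \<Rightarrow> nat \<Rightarrow> real" where
  "mean_fraction k j m = expect m (fraction k j)"

text \<open>Identifies the mean with the joint probability \<open>q\<^sub>j(m)\<close>, computed by
  fixing the short word w first.\<close>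

lemma mean_fraction_swap:
  "mean_fraction k j m = expect k (\<lambda>w. expect m (\<lambda>u. of_bool (occurrences w u = j)))"
  unfolding mean_fraction_def fraction_def by (rule expect_swap)

text \<open>Cutting the word before and after the window exhibits the window as an independent
  uniform word.\<close>

lemma expect_window:
  assumes "w \<in> words k" "p \<le> m"
  shows "expect (m + k) (\<lambda>u. of_bool (take k (drop p u) = w)) = 1 / real b ^ k"
proof -
  have "m + k = p + (k + (m - p))" using assms by simp
  then have "expect (m + k) (\<lambda>u. of_bool (take k (drop p u) = w)) =
      expect p (\<lambda>r. expect k (\<lambda>s. expect (m - p) (\<lambda>t. of_bool (take k (drop p (r @ s @ t)) = w))))"
    by (simp only: expect_append)
  also have "\<dots> = expect p (\<lambda>r. expect k (\<lambda>s. expect (m - p) (\<lambda>t. of_bool (s = w))))"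
    by (intro expect_cong) (simp add: words_length)
  finally show ?thesis using assms by (simp add: expect_of_bool_eq)
qed

text \<open>The condition forces w to start with s and to continue with period
  \<open>length s\<close>, so its letters are determined by s one after another.\<close>

lemma self_overlap_unique:
  assumes "0 < length s" "length w = k" "length w' = k"
    and "take k (s @ w) = w" "take k (s @ w') = w'"
  shows "w = w'"
proof (rule nth_equalityI)
  show "length w = length w'" using assms by simp
  fix i assume "i < length w"
  then show "w ! i = w' ! i"
  proof (induction i rule: less_induct)
    case (less i)
    have "w ! i = (s @ w) ! i" "w' ! i = (s @ w') ! i"
      using less.prems assms by (metis nth_take)+
    then show ?case
      using less.IH[of "i - length s"] less.prems assms(1)
      by (cases "i < length s") (auto simp: nth_append)
  qed
qed

text \<open>A word and its prescribed shift by \<open>m - p\<close> overlap only if the word is determined by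
  its first \<open>m - p\<close> letters; averaging over the word therefore gives the same bound as for
  disjoint windows.\<close>

lemma expect_two_windows:
  assumes "p < m"
  shows "expect k (\<lambda>w. expect (m + k) (\<lambda>u. of_bool (take k (drop p u) = w \<and> drop m u = w)))
    \<le> (1 / real b ^ k)\<^sup>2"
proof -
  have mk: "m + k = p + ((m - p) + k)" using assms by simp
  have "expect (m + k) (\<lambda>u. of_bool (take k (drop p u) = w \<and> drop m u = w)) =
      expect (m - p) (\<lambda>s. 1 / real b ^ k * of_bool (take k (s @ w) = w))" if w: "w \<in> words k" for w
  proof -
    have "expect (m + k) (\<lambda>u. of_bool (take k (drop p u) = w \<and> drop m u = w)) =
        expect p (\<lambda>r. expect (m - p) (\<lambda>s. expect k (\<lambda>t.
          of_bool (take k (drop p (r @ s @ t)) = w \<and> drop m (r @ s @ t) = w))))"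
      by (simp only: mk expect_append)
    \<comment> \<open>Once the last window t equals w, the window at p is the beginning of
      \<open>s @ w\<close>, a condition on s and w alone.\<close>
    also have "\<dots> = expect p (\<lambda>r. expect (m - p) (\<lambda>s. expect k (\<lambda>t.
          of_bool (take k (s @ w) = w) * of_bool (t = w))))"
      using assms by (intro expect_cong) (auto simp: words_length)
    also have "\<dots> = expect (m - p) (\<lambda>s. 1 / real b ^ k * of_bool (take k (s @ w) = w))"
      unfolding expect_const expect_cmult expect_of_bool_eq[OF w]
      by (subst mult.commute, simp only: expect_cmult)
    finally show ?thesis .
  qed
  then have "expect k (\<lambda>w. expect (m + k) (\<lambda>u. of_bool (take k (drop p u) = w \<and> drop m u = w))) =
      expect k (\<lambda>w. expect (m - p) (\<lambda>s. 1 / real b ^ k * of_bool (take k (s @ w) = w)))"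
    by (rule expect_cong)
  also have "\<dots> = 1 / real b ^ k * expect (m - p) (\<lambda>s. expect k (\<lambda>w. of_bool (take k (s @ w) = w)))"
    unfolding expect_cmult expect_swap[of k "m - p"] ..
  also have "expect (m - p) (\<lambda>s. expect k (\<lambda>w. of_bool (take k (s @ w) = w))) \<le>
      expect (m - p) (\<lambda>s. 1 / real b ^ k)"
  proof (rule expect_mono)
    fix s assume "s \<in> words (m - p)"
    then have s: "0 < length s" using assms by (simp add: words_length)
    let ?A = "{w \<in> words k. take k (s @ w) = w}"
    have "card ?A \<le> 1"
      using self_overlap_unique[OF s] by (auto simp: card_le_Suc0_iff_eq words_length)
    then show "expect k (\<lambda>w. of_bool (take k (s @ w) = w)) \<le> 1 / real b ^ k"
      unfolding expect_of_bool by (intro divide_right_mono) auto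
  qed
  finally show ?thesis
    using b_pow_pos[of k] by (simp add: power2_eq_square divide_right_mono field_simps)
qed

end

section \<open>The mean number of occurrences\<close>

definition poisson :: "nat \<Rightarrow> real \<Rightarrow> real" where
  "poisson j t = exp (- t) * t ^ j / fact j"

text \<open>The weight of index j - 1; the value 0 at j = 0 gives the differential equation the same
  form for all j.\<close>

definition poisson_pred :: "nat \<Rightarrow> real \<Rightarrow> real" where
  "poisson_pred j t = (case j of 0 \<Rightarrow> 0 | Suc i \<Rightarrow> poisson i t)"

lemma poisson_bounds:
  assumes "0 \<le> t"
  shows "0 \<le> poisson j t" "poisson j t \<le> 1"
proof -
  show "0 \<le> poisson j t" using assms by (simp add: poisson_def)
  have s: "(\<lambda>n. t ^ n / fact n) sums exp t"
    using exp_converges[of t] by (simp add: field_simps)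
  have "(\<Sum>n\<in>{j}. t ^ n / fact n) \<le> (\<Sum>n. t ^ n / fact n)"
    by (rule sum_le_suminf) (use assms s in \<open>auto simp: sums_iff\<close>)
  then have "t ^ j / fact j \<le> exp t" using s by (simp add: sums_iff)
  then have "exp (- t) * (t ^ j / fact j) \<le> exp (- t) * exp t" by (intro mult_left_mono) auto
  then show "poisson j t \<le> 1" by (simp add: poisson_def exp_minus)
qed

lemma poisson_pred_bounds:
  assumes "0 \<le> t"
  shows "0 \<le> poisson_pred j t" "poisson_pred j t \<le> 1"
  using assms by (auto simp: poisson_pred_def poisson_bounds split: nat.split)

lemma DERIV_poisson: "(poisson j has_real_derivative poisson_pred j t - poisson j t) (at t)"
proof (cases j)
  case 0
  then show ?thesis
    unfolding poisson_def[abs_def] poisson_pred_def by (auto intro!: derivative_eq_intros)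
next
  case (Suc i)
  have "((\<lambda>t. exp (- t) * t ^ Suc i / fact (Suc i)) has_real_derivative
      (exp (- t) * (real (Suc i) * t ^ i) - exp (- t) * t ^ Suc i) / fact (Suc i)) (at t)"
    by (auto intro!: derivative_eq_intros simp del: power_Suc fact_Suc of_nat_Suc)
  moreover have "(exp (- t) * (real (Suc i) * t ^ i) - exp (- t) * t ^ Suc i) / fact (Suc i) =
      poisson_pred (Suc i) t - poisson (Suc i) t"
    by (simp add: poisson_def poisson_pred_def diff_divide_distrib del: of_nat_Suc power_Suc)
  ultimately show ?thesis
    unfolding poisson_def[abs_def] Suc by (simp only:)
qed

lemma poisson_lipschitz:
  assumes "0 \<le> t" "0 \<le> s"
  shows "\<bar>poisson j (t + s) - poisson j t\<bar> \<le> s"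
proof (cases "s = 0")
  case False
  then obtain z where z: "t < z" "poisson j (t + s) - poisson j t = s * (poisson_pred j z - poisson j z)"
    using MVT2[of t "t + s" "poisson j" "\<lambda>t. poisson_pred j t - poisson j t"] DERIV_poisson assms
    by auto
  have "\<bar>poisson_pred j z - poisson j z\<bar> \<le> 1"
    using z(1) assms poisson_bounds[of z j] poisson_pred_bounds[of z j] by auto
  then show ?thesis using z assms by (simp add: abs_mult mult_left_le)
qed simp

lemma poisson_pred_lipschitz:
  assumes "0 \<le> t" "0 \<le> s"
  shows "\<bar>poisson_pred j (t + s) - poisson_pred j t\<bar> \<le> s"
  using poisson_lipschitz[OF assms] assms by (auto simp: poisson_pred_def split: nat.split)

text \<open>By the mean value theorem the increment is h times the derivative at an intermediate
  point, and the derivative moves by at most 2 h there since both of its terms are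
  1-Lipschitz.\<close>

lemma poisson_euler_step:
  assumes "0 \<le> t" "0 \<le> h"
  shows "\<bar>poisson j (t + h) - poisson j t - h * (poisson_pred j t - poisson j t)\<bar> \<le> 2 * h\<^sup>2"
proof (cases "h = 0")
  case False
  let ?D = "\<lambda>s. poisson_pred j s - poisson j s"
  obtain z where z: "t < z" "z < t + h" "poisson j (t + h) - poisson j t = h * ?D z"
    using MVT2[of t "t + h" "poisson j" ?D] DERIV_poisson assms False by auto
  have "\<bar>?D z - ?D t\<bar> \<le> 2 * h"
    using poisson_lipschitz[of t "z - t" j] poisson_pred_lipschitz[of t "z - t" j] z assms by auto
  then have "\<bar>h * (?D z - ?D t)\<bar> \<le> h * (2 * h)"
    using assms by (simp add: abs_mult mult_left_mono)
  then show ?thesis using z(3) by (simp add: power2_eq_square algebra_simps)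
qed simp

lemma continuous_poisson: "isCont (poisson j) t"
  using DERIV_poisson by (rule DERIV_isCont)

section \<open>The Euler scheme satisfied by the mean fractions\<close>

context base
begin

text \<open>The starting points of the earlier windows that share a letter with the window at m;
  only these make that window depend on the earlier count.\<close>

definition overlaps :: "nat \<Rightarrow> nat \<Rightarrow> nat set" where
  "overlaps m k = {p. m < p + k \<and> p < m}"

lemma finite_overlaps: "finite (overlaps m k)"
  by (rule finite_subset[of _ "{..m}"]) (auto simp: overlaps_def)

lemma card_overlaps: "card (overlaps m k) \<le> k"
proof -
  have "overlaps m k \<subseteq> {m - k..<m - k + k}" by (auto simp: overlaps_def)
  from card_mono[OF _ this] show ?thesis by simp
qed

text \<open>An occurrence in \<open>butlast u\<close> that is lost in \<open>take m u\<close> must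
  start in \<open>overlaps m k\<close>; if there is one, the sum is at least 1.\<close>

lemma occurrences_take_butlast:
  assumes "u \<in> words (m + k)" "w \<in> words k" "0 < k"
  shows "\<bar>of_bool (occurrences w (butlast u) = j) - of_bool (occurrences w (take m u) = j)\<bar>
    \<le> (\<Sum>p\<in>overlaps m k. of_bool (take k (drop p u) = w) :: real)"
proof (cases "\<exists>p\<in>overlaps m k. take k (drop p u) = w")
  case True
  then obtain p where p: "p \<in> overlaps m k" "take k (drop p u) = w" by blast
  have "(1::real) = (\<Sum>p\<in>{p}. of_bool (take k (drop p u) = w))" using p by simp
  also have "\<dots> \<le> (\<Sum>p\<in>overlaps m k. of_bool (take k (drop p u) = w))"
    using p by (intro sum_mono2 finite_overlaps) auto
  finally show ?thesis by (rule order_trans[rotated]) (simp add: of_bool_def)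
next
  case False
  have "occurrences w (butlast u) = occurrences w (take m u)"
  proof (rule occurrences_cong)
    fix p
    have "p + k \<le> m" if "occurs_at w p u" "p < m"
      using that False assms by (fastforce simp: overlaps_def occurs_at_def words_length not_le)
    then show "occurs_at w p (butlast u) \<longleftrightarrow> occurs_at w p (take m u)"
      unfolding butlast_conv_take occurs_at_take using assms by (auto simp: words_length)
  qed
  then show ?thesis by (simp add: sum_nonneg)
qed

lemma expect_butlast:
  assumes "0 < n"
  shows "expect n (\<lambda>u. f (butlast u)) = expect (n - 1) f"
proof -
  have "expect (n - 1 + 1) (\<lambda>u. f (butlast u)) = expect (n - 1 + 1) (\<lambda>u. f (take (n - 1) u))"
    by (intro expect_cong) (simp add: butlast_conv_take words_length)
  then show ?thesis using assms by (simp only: expect_take) simp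
qed

text \<open>The first m and the last k letters are independent, so the joint probability is a
  product.\<close>

lemma mean_fraction_window:
  "expect k (\<lambda>w. expect (m + k) (\<lambda>u. of_bool (occurrences w (take m u) = j \<and> drop m u = w)))
    = mean_fraction k j m / real b ^ k"
proof -
  have "expect (m + k) (\<lambda>u. of_bool (occurrences w (take m u) = j \<and> drop m u = w)) =
      1 / real b ^ k * expect m (\<lambda>u. of_bool (occurrences w u = j))" if w: "w \<in> words k" for w
  proof -
    have "expect (m + k) (\<lambda>u. of_bool (occurrences w (take m u) = j \<and> drop m u = w)) =
        expect m (\<lambda>u. expect k (\<lambda>v. of_bool (occurrences w u = j) * of_bool (v = w)))"
      unfolding expect_append by (intro expect_cong) (auto simp: words_length)
    also have "\<dots> = expect m (\<lambda>u. 1 / real b ^ k * of_bool (occurrences w u = j))"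
      unfolding expect_cmult expect_of_bool_eq[OF w] by (subst mult.commute, simp only: expect_cmult)
    finally show ?thesis by (simp only: expect_cmult)
  qed
  then have "expect k (\<lambda>w. expect (m + k) (\<lambda>u. of_bool (occurrences w (take m u) = j \<and> drop m u = w)))
      = expect k (\<lambda>w. 1 / real b ^ k * expect m (\<lambda>u. of_bool (occurrences w u = j)))"
    by (rule expect_cong)
  then show ?thesis unfolding expect_cmult mean_fraction_swap by simp
qed

text \<open>The count in \<open>butlast u\<close> is replaced by the count in
  \<open>take m u\<close>, which is independent of the last window. With h =
  \<open>1 / real b ^ k\<close>, this costs k h^2 in the joint probability by
  \<open>expect_two_windows\<close>, and again k h^2 in the product, where the mean changes by at
  most k h and is multiplied by h.\<close>

lemma last_window_decouples:
  assumes "0 < k"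
  shows "\<bar>expect k (\<lambda>w. expect (m + k) (\<lambda>u. of_bool (occurrences w (butlast u) = j \<and> drop m u = w)))
      - mean_fraction k j (m + k - 1) / real b ^ k\<bar> \<le> 2 * real k * (1 / real b ^ k)\<^sup>2"
    (is "\<bar>?F - _\<bar> \<le> _")
proof -
  let ?h = "1 / real b ^ k"
  have cardh: "real (card (overlaps m k)) * c \<le> k * c" if "0 \<le> c" for c :: real
    using card_overlaps[of m k] that by (intro mult_right_mono) auto
  have eq1: "?F - mean_fraction k j m / real b ^ k =
      expect k (\<lambda>w. expect (m + k) (\<lambda>u.
        of_bool (occurrences w (butlast u) = j \<and> drop m u = w)
        - of_bool (occurrences w (take m u) = j \<and> drop m u = w)))"
    by (simp only: expect_diff mean_fraction_window)
  have "\<bar>?F - mean_fraction k j m / real b ^ k\<bar> \<le> expect k (\<lambda>w. \<bar>expect (m + k) (\<lambda>u.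
        of_bool (occurrences w (butlast u) = j \<and> drop m u = w)
        - of_bool (occurrences w (take m u) = j \<and> drop m u = w))\<bar>)"
    unfolding eq1 by (rule expect_abs)
  also have "\<dots> \<le> expect k (\<lambda>w. expect (m + k) (\<lambda>u.
        \<bar>of_bool (occurrences w (butlast u) = j \<and> drop m u = w)
        - of_bool (occurrences w (take m u) = j \<and> drop m u = w)\<bar>))"
    by (intro expect_mono expect_abs)
  also have "\<dots> \<le> expect k (\<lambda>w. expect (m + k) (\<lambda>u.
        \<Sum>p\<in>overlaps m k. of_bool (take k (drop p u) = w \<and> drop m u = w)))"
  proof (intro expect_mono)
    fix w u assume "w \<in> words k" "u \<in> words (m + k)"
    then show "\<bar>of_bool (occurrences w (butlast u) = j \<and> drop m u = w)
        - of_bool (occurrences w (take m u) = j \<and> drop m u = w)\<bar>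
        \<le> (\<Sum>p\<in>overlaps m k. of_bool (take k (drop p u) = w \<and> drop m u = w) :: real)"
      using occurrences_take_butlast[of u m k w j] assms
      by (cases "drop m u = w") (auto simp: sum_nonneg)
  qed
  also have "\<dots> = (\<Sum>p\<in>overlaps m k. expect k (\<lambda>w. expect (m + k) (\<lambda>u.
        of_bool (take k (drop p u) = w \<and> drop m u = w))))"
    by (simp only: expect_sum)
  also have "\<dots> \<le> (\<Sum>p\<in>overlaps m k. ?h\<^sup>2)"
    by (intro sum_mono expect_two_windows) (simp add: overlaps_def)
  also have "\<dots> \<le> k * ?h\<^sup>2" using cardh[of "?h\<^sup>2"] by simp
  finally have 1: "\<bar>?F - mean_fraction k j m / real b ^ k\<bar> \<le> k * ?h\<^sup>2" .

  have eq2: "mean_fraction k j (m + k - 1) - mean_fraction k j m =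
      expect k (\<lambda>w. expect (m + k) (\<lambda>u.
        of_bool (occurrences w (butlast u) = j) - of_bool (occurrences w (take m u) = j)))"
    unfolding expect_diff mean_fraction_swap
    by (subst expect_butlast, use assms in simp, subst expect_take, rule refl)
  have "\<bar>mean_fraction k j (m + k - 1) - mean_fraction k j m\<bar> \<le> expect k (\<lambda>w. \<bar>expect (m + k) (\<lambda>u.
        of_bool (occurrences w (butlast u) = j) - of_bool (occurrences w (take m u) = j))\<bar>)"
    unfolding eq2 by (rule expect_abs)
  also have "\<dots> \<le> expect k (\<lambda>w. expect (m + k) (\<lambda>u.
        \<bar>of_bool (occurrences w (butlast u) = j) - of_bool (occurrences w (take m u) = j)\<bar>))"
    by (intro expect_mono expect_abs)
  also have "\<dots> \<le> expect k (\<lambda>w. expect (m + k) (\<lambda>u.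
        \<Sum>p\<in>overlaps m k. of_bool (take k (drop p u) = w)))"
    using assms by (intro expect_mono occurrences_take_butlast)
  also have "\<dots> = expect k (\<lambda>w. \<Sum>p\<in>overlaps m k. ?h)"
    unfolding expect_sum
    by (intro expect_cong sum.cong refl expect_window) (auto simp: overlaps_def)
  also have "\<dots> \<le> k * ?h" using cardh[of ?h] by simp
  finally have "\<bar>mean_fraction k j (m + k - 1) - mean_fraction k j m\<bar> \<le> k * ?h" .
  then have "?h * \<bar>mean_fraction k j (m + k - 1) - mean_fraction k j m\<bar> \<le> ?h * (k * ?h)"
    by (intro mult_left_mono) auto
  then have 2: "\<bar>?h * mean_fraction k j (m + k - 1) - ?h * mean_fraction k j m\<bar> \<le> k * ?h\<^sup>2"
    unfolding right_diff_distrib[symmetric] abs_mult by (simp add: power2_eq_square mult.commute)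
  show ?thesis using 1 2 by simp
qed

definition mean_fraction_pred :: "nat \<Rightarrow> nat \<Rightarrow> nat \<Rightarrow> real" where
  "mean_fraction_pred k j m = (case j of 0 \<Rightarrow> 0 | Suc i \<Rightarrow> mean_fraction k i m)"

text \<open>One more letter creates one new window. If it reads w, the count passes from j - 1 to j,
  a gain, or from j to j + 1, a loss; both probabilities are given by
  \<open>last_window_decouples\<close>.\<close>

lemma mean_fraction_euler_step:
  assumes "0 < k"
  shows "\<bar>mean_fraction k j (m + k) - mean_fraction k j (m + k - 1)
      - (mean_fraction_pred k j (m + k - 1) - mean_fraction k j (m + k - 1)) / real b ^ k\<bar>
    \<le> 4 * real k * (1 / real b ^ k)\<^sup>2"
proof -
  define F where "F i = expect k (\<lambda>w. expect (m + k) (\<lambda>u.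
      of_bool (occurrences w (butlast u) = i \<and> drop m u = w)))" for i
  have F: "\<bar>F i - mean_fraction k i (m + k - 1) / real b ^ k\<bar> \<le> 2 * real k * (1 / real b ^ k)\<^sup>2" for i
    unfolding F_def by (rule last_window_decouples[OF assms])
  have "mean_fraction k j (m + k) - mean_fraction k j (m + k - 1) =
      expect k (\<lambda>w. expect (m + k) (\<lambda>u.
        of_bool (occurrences w u = j) - of_bool (occurrences w (butlast u) = j)))"
    unfolding expect_diff mean_fraction_swap
    by (subst expect_butlast) (use assms in auto)
  also have "\<dots> = expect k (\<lambda>w. expect (m + k) (\<lambda>u.
        (case j of 0 \<Rightarrow> 0 | Suc i \<Rightarrow> of_bool (occurrences w (butlast u) = i \<and> drop m u = w))
        - of_bool (occurrences w (butlast u) = j \<and> drop m u = w)))"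
    using assms
    by (intro expect_cong)
      (auto simp: occurrences_butlast words_length of_bool_def split: nat.split)
  also have "\<dots> = (case j of 0 \<Rightarrow> 0 | Suc i \<Rightarrow> F i) - F j"
    by (cases j) (simp_all only: F_def expect_diff nat.case expect_const)
  finally have eq: "mean_fraction k j (m + k) - mean_fraction k j (m + k - 1) =
      (case j of 0 \<Rightarrow> 0 | Suc i \<Rightarrow> F i) - F j" .
  have "0 \<le> 2 * real k * (1 / real b ^ k)\<^sup>2" by simp
  then show ?thesis
    unfolding eq mean_fraction_pred_def diff_divide_distrib
    using F[of j] F[of "j - 1"] by (cases j) auto
qed

text \<open>Both sides are Euler schemes with step \<open>b\<^sup>-\<^sup>k\<close> for
  \<open>p\<^sub>j' = p\<^sub>j\<^sub>-\<^sub>1 - p\<^sub>j\<close>, and a step is a convex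
  combination, hence does not increase the supremum over \<open>j\<close> of the error.\<close>

lemma mean_fraction_poisson:
  assumes "0 < k"
  shows "\<bar>mean_fraction k j (k - 1 + n) - poisson j (real n / real b ^ k)\<bar>
    \<le> real n * ((4 * real k + 2) * (1 / real b ^ k)\<^sup>2)"
proof (induction n arbitrary: j)
  case 0
  \<comment> \<open>A word of length k - 1 has no window of length k, so the scheme starts with all
    mass at j = 0, as the Poisson weights do at time 0.\<close>
  have "occurrences w u = 0" if "w \<in> words k" "u \<in> words (k - 1)" for w u
  proof -
    have "\<not> p + length w \<le> length u" for p
      using that assms by (simp add: words_length)
    then have "\<not> occurs_at w p u" for p
      by (simp add: occurs_at_def)
    then show ?thesis by (simp add: occurrences_def)
  qed
  then have "mean_fraction k j (k - 1) = expect k (\<lambda>w. expect (k - 1) (\<lambda>u. of_bool (0 = j)))"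
    unfolding mean_fraction_swap by (intro expect_cong) auto
  then show ?case by (simp add: poisson_def of_bool_def power_0_left)
next
  case (Suc n)
  define h where "h = 1 / real b ^ k"
  define e where "e = real n * ((4 * real k + 2) * h\<^sup>2)"
  define q where "q = mean_fraction k j (k - 1 + n)"
  define q' where "q' = mean_fraction_pred k j (k - 1 + n)"
  define p where "p = poisson j (real n * h)"
  define p' where "p' = poisson_pred j (real n * h)"
  have h: "0 \<le> h" "h \<le> 1" using b2 by (auto simp: h_def)
  have IH: "\<bar>mean_fraction k i (k - 1 + n) - poisson i (real n * h)\<bar> \<le> e" for i
    using Suc.IH[of i] by (simp add: e_def h_def)
  have 1: "\<bar>q - p\<bar> \<le> e" using IH by (simp add: q_def p_def)
  have "0 \<le> e" by (simp add: e_def)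
  then have 2: "\<bar>q' - p'\<bar> \<le> e"
    using IH by (auto simp: q'_def p'_def mean_fraction_pred_def poisson_pred_def split: nat.split)
  have "\<bar>(1 - h) * (q - p) + h * (q' - p')\<bar> \<le> \<bar>(1 - h) * (q - p)\<bar> + \<bar>h * (q' - p')\<bar>"
    by (rule abs_triangle_ineq)
  also have "\<dots> \<le> (1 - h) * e + h * e"
    unfolding abs_mult using h 1 2 by (intro add_mono mult_mono) auto
  finally have 3: "\<bar>(1 - h) * (q - p) + h * (q' - p')\<bar> \<le> e" by (simp add: algebra_simps)
  have eqs: "n + k - 1 = k - 1 + n" "n + k = k - 1 + Suc n" using assms by auto
  have 4: "\<bar>mean_fraction k j (k - 1 + Suc n) - q - h * (q' - q)\<bar> \<le> 4 * real k * h\<^sup>2"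
    using mean_fraction_euler_step[OF assms, of j n] unfolding eqs q_def q'_def h_def by simp
  have "real (Suc n) * h = real n * h + h" by (simp add: algebra_simps)
  then have 5: "\<bar>poisson j (real (Suc n) * h) - p - h * (p' - p)\<bar> \<le> 2 * h\<^sup>2"
    using poisson_euler_step[of "real n * h" h j] h by (simp add: p_def p'_def)
  have "\<bar>mean_fraction k j (k - 1 + Suc n) - poisson j (real (Suc n) * h)\<bar>
      \<le> e + 4 * real k * h\<^sup>2 + 2 * h\<^sup>2"
    using 3 4 5 by (simp add: algebra_simps abs_le_iff)
  also have "\<dots> = real (Suc n) * ((4 * real k + 2) * h\<^sup>2)"
    by (simp add: e_def algebra_simps)
  finally show ?case by (simp add: h_def)
qed

text \<open>The summand 1 appears because n + 1 Euler steps lead from length k - 1 to length n +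
  k.\<close>

lemma tendsto_floor_div: "(\<lambda>k. real (nat \<lfloor>l * real b ^ k\<rfloor> + 1) / real b ^ k) \<longlonglongrightarrow> l"
  if "0 \<le> l"
proof (rule tendsto_sandwich[where f = "\<lambda>_. l" and h = "\<lambda>k. l + (1 / real b) ^ k"])
  have l0: "real (nat \<lfloor>l * real b ^ k\<rfloor>) = of_int \<lfloor>l * real b ^ k\<rfloor>" for k
    using that by simp
  have "l * real b ^ k \<le> real (nat \<lfloor>l * real b ^ k\<rfloor> + 1)" for k
    using l0[of k] real_of_int_floor_add_one_ge[of "l * real b ^ k"] by linarith
  then show "\<forall>\<^sub>F k in sequentially. l \<le> real (nat \<lfloor>l * real b ^ k\<rfloor> + 1) / real b ^ k"
    using b_pow_pos by (auto simp: pos_le_divide_eq)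
  have "real (nat \<lfloor>l * real b ^ k\<rfloor> + 1) \<le> l * real b ^ k + 1" for k
    using l0[of k] of_int_floor_le[of "l * real b ^ k"] by simp
  then have "real (nat \<lfloor>l * real b ^ k\<rfloor> + 1) / real b ^ k \<le> (l * real b ^ k + 1) / real b ^ k" for k
    using b_pow_pos by (intro divide_right_mono) auto
  also have "(l * real b ^ k + 1) / real b ^ k = l + (1 / real b) ^ k" for k
    using b2 by (simp add: add_divide_distrib power_divide)
  finally show "\<forall>\<^sub>F k in sequentially.
      real (nat \<lfloor>l * real b ^ k\<rfloor> + 1) / real b ^ k \<le> l + (1 / real b) ^ k"
    by simp
  have "(\<lambda>k. (1 / real b) ^ k) \<longlonglongrightarrow> 0" using b2 by (intro LIMSEQ_realpow_zero) auto
  then show "(\<lambda>k. l + (1 / real b) ^ k) \<longlonglongrightarrow> l"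
    using tendsto_add[OF tendsto_const[of l]] by fastforce
qed simp

lemma summable_poly_div_b_pow: "summable (\<lambda>k. real k ^ n / real b ^ k)"
proof (rule summable_comparison_test_ev)
  \<comment> \<open>The power of 3/2 absorbs the polynomial and still leaves the ratio 3/4 against
    \<open>2 \<le> b\<close>.\<close>
  have "(\<lambda>k::nat. real k ^ n / (3/2) ^ k) \<longlonglongrightarrow> 0" by real_asymp
  then have "\<forall>\<^sub>F k in sequentially. real k ^ n / (3/2) ^ k < 1"
    by (rule order_tendstoD) simp
  then show "\<forall>\<^sub>F k in sequentially. norm (real k ^ n / real b ^ k) \<le> (3/4) ^ k"
  proof eventually_elim
    case (elim k)
    have "real k ^ n / real b ^ k \<le> (3/2) ^ k / 2 ^ k"
      using elim b2 by (intro frac_le power_mono) (auto simp: field_simps)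
    also have "\<dots> = (3/4) ^ k" by (simp add: power_divide[symmetric])
    finally show ?case by simp
  qed
  show "summable (\<lambda>k. (3/4 :: real) ^ k)" by (simp add: summable_geometric)
qed

lemma tendsto_poly_div_b_pow: "(\<lambda>k. real k ^ n / real b ^ k) \<longlonglongrightarrow> 0"
  by (rule summable_LIMSEQ_zero) (rule summable_poly_div_b_pow)

text \<open>About \<open>l * real b ^ k\<close> steps, each with an error of order k divided by the
  square of \<open>b ^ k\<close>, accumulate an error of order \<open>k / b ^ k\<close>.\<close>

lemma tendsto_mean_fraction:
  assumes "0 \<le> l"
  shows "(\<lambda>k. mean_fraction k j (nat \<lfloor>l * real b ^ k\<rfloor> + k)) \<longlonglongrightarrow> poisson j l"
proof -
  define t where "t k = real (nat \<lfloor>l * real b ^ k\<rfloor> + 1) / real b ^ k" for k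
  have t: "t \<longlonglongrightarrow> l" using tendsto_floor_div[OF assms] by (simp add: t_def[abs_def])
  have "(\<lambda>k. mean_fraction k j (nat \<lfloor>l * real b ^ k\<rfloor> + k) - poisson j (t k)) \<longlonglongrightarrow> 0"
  proof (rule Lim_null_comparison)
    show "\<forall>\<^sub>F k in sequentially. norm (mean_fraction k j (nat \<lfloor>l * real b ^ k\<rfloor> + k) - poisson j (t k))
        \<le> t k * (4 * (real k ^ 1 / real b ^ k) + 2 * (real k ^ 0 / real b ^ k))"
      using eventually_gt_at_top[of 0]
    proof eventually_elim
      case (elim k)
      have "k - 1 + (nat \<lfloor>l * real b ^ k\<rfloor> + 1) = nat \<lfloor>l * real b ^ k\<rfloor> + k" using elim by simp
      then have "\<bar>mean_fraction k j (nat \<lfloor>l * real b ^ k\<rfloor> + k) - poisson j (t k)\<bar>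
        \<le> real (nat \<lfloor>l * real b ^ k\<rfloor> + 1) * ((4 * real k + 2) * (1 / real b ^ k)\<^sup>2)"
        using mean_fraction_poisson[OF elim, of j "nat \<lfloor>l * real b ^ k\<rfloor> + 1"] unfolding t_def by metis
      also have "\<dots> = t k * (4 * (real k ^ 1 / real b ^ k) + 2 * (real k ^ 0 / real b ^ k))"
        using b_pow_pos[of k] by (simp add: t_def power2_eq_square divide_simps)
      finally show ?case by simp
    qed
    have "(\<lambda>k. t k * (4 * (real k ^ 1 / real b ^ k) + 2 * (real k ^ 0 / real b ^ k)))
        \<longlonglongrightarrow> l * (4 * 0 + 2 * 0)"
      by (intro tendsto_intros t tendsto_poly_div_b_pow)
    then show "(\<lambda>k. t k * (4 * (real k ^ 1 / real b ^ k) + 2 * (real k ^ 0 / real b ^ k))) \<longlonglongrightarrow> 0"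
      by simp
  qed
  moreover have "(\<lambda>k. poisson j (t k)) \<longlonglongrightarrow> poisson j l"
    by (rule isCont_tendsto_compose[OF continuous_poisson t])
  ultimately show ?thesis using tendsto_add by fastforce
qed

end

section \<open>Existence of Poisson generic sequences\<close>

context base
begin

text \<open>Konig's lemma for the b-ary tree: the digits are chosen one by one, keeping a prefix
  that has good extensions of every length.\<close>

lemma konig_digits:
  assumes ex: "\<And>n. \<exists>v\<in>words n. Good v" and take: "\<And>v n. Good v \<Longrightarrow> Good (take n v)"
  shows "\<exists>d. (\<forall>i. d i < b) \<and> (\<forall>n. Good (map d [0..<n]))"
proof -
  define ext where "ext u \<longleftrightarrow> (\<forall>m\<ge>length u. \<exists>v\<in>words m. take (length u) v = u \<and> Good v)" for u
  have step: "\<exists>a<b. ext (u @ [a])" if "ext u" for u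
  proof (rule ccontr)
    assume "\<not> ?thesis"
    then have "\<forall>a. \<exists>m. a < b \<longrightarrow> Suc (length u) \<le> m \<and>
        \<not> (\<exists>v\<in>words m. take (Suc (length u)) v = u @ [a] \<and> Good v)"
      by (auto simp: ext_def)
    then obtain m where m: "\<And>a. a < b \<Longrightarrow> Suc (length u) \<le> m a"
      "\<And>a v. a < b \<Longrightarrow> v \<in> words (m a) \<Longrightarrow> take (Suc (length u)) v = u @ [a] \<Longrightarrow> \<not> Good v"
      by metis
    \<comment> \<open>If every letter a failed at some length \<open>m a\<close>, then a good
      extension of u of length M, cut down to \<open>m a\<close> for its own next letter a, would
      contradict that failure.\<close>
    define M where "M = Suc (length u) + (\<Sum>a<b. m a)"
    have "length u \<le> M" by (simp add: M_def)
    then obtain v where v: "v \<in> words M" "take (length u) v = u" "Good v"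
      using \<open>ext u\<close> unfolding ext_def by blast
    have len: "length u < length v" using v(1) by (simp add: words_length M_def)
    define a where "a = v ! length u"
    have "a < b" using v(1) nth_mem[OF len] unfolding words_def a_def by blast
    moreover have "m a \<le> M"
      using member_le_sum[of a "{..<b}" m] \<open>a < b\<close> by (simp add: M_def)
    moreover have "take (Suc (length u)) (take (m a) v) = u @ [a]"
      using m(1)[OF \<open>a < b\<close>] len v(2) by (simp add: take_take min_absorb1 take_Suc_conv_app_nth a_def)
    ultimately show False using m(2) take_in_words[OF v(1)] take[OF v(3)] by blast
  qed
  have "\<exists>f. \<forall>n. (length (f n) = n \<and> ext (f n)) \<and> (\<exists>a<b. f (Suc n) = f n @ [a])"
  proof (rule dependent_nat_choice)
    show "\<exists>u. length u = 0 \<and> ext u" using ex by (auto simp: ext_def)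
    fix u n assume u: "length u = n \<and> ext u"
    then obtain a where "a < b" "ext (u @ [a])" using step by blast
    then show "\<exists>u'. (length u' = Suc n \<and> ext u') \<and> (\<exists>a<b. u' = u @ [a])"
      using u by (intro exI[of _ "u @ [a]"]) auto
  qed
  then obtain f where f: "\<And>n. length (f n) = n" "\<And>n. ext (f n)" "\<And>n. \<exists>a<b. f (Suc n) = f n @ [a]"
    by blast
  define d where "d n = last (f (Suc n))" for n
  have d: "f (Suc n) = f n @ [d n] \<and> d n < b" for n
    using f(3)[of n] by (auto simp: d_def)
  have "map d [0..<n] = f n" for n
  proof (induction n)
    case 0 then show ?case using f(1)[of 0] by simp
  qed (use d in simp)
  moreover have "Good (f n)" for n
    using f(1,2)[of n] unfolding ext_def by (auto simp: words_length)
  ultimately show ?thesis using d by (intro exI[of _ d]) auto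
qed

text \<open>Beyond some K the failure probabilities sum to less than 1, so words of every length
  satisfy all conditions with \<open>k \<ge> K\<close> that they are long enough to decide. These
  words feed Konig's lemma.\<close>

lemma borel_cantelli_digits:
  assumes bad: "\<And>k. expect (L k) (\<lambda>u. of_bool (\<not> G k u)) \<le> \<beta> k"
    and "summable \<beta>" and L: "\<And>k. k \<le> L k"
  shows "\<exists>d. (\<forall>i. d i < b) \<and> (\<forall>\<^sub>F k in sequentially. G k (map d [0..<L k]))"
proof -
  obtain K where K: "\<And>m n. K \<le> m \<Longrightarrow> norm (sum \<beta> {m..<n}) < 1"
    using \<open>summable \<beta>\<close> unfolding summable_Cauchy by (meson zero_less_one)
  define Good where "Good v \<longleftrightarrow> (\<forall>k\<ge>K. L k \<le> length v \<longrightarrow> G k (take (L k) v))" for v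
  have pos: "0 \<le> \<beta> k" for k
    using bad[of k] expect_mono[of "L k" "\<lambda>_. 0" "\<lambda>u. of_bool (\<not> G k u)"] by simp
  have "\<exists>d. (\<forall>i. d i < b) \<and> (\<forall>n. Good (map d [0..<n]))"
  proof (rule konig_digits)
    fix n
    \<comment> \<open>Since \<open>k \<le> L k\<close>, a word of length n decides only conditions
      with \<open>k \<le> n\<close>.\<close>
    define I where "I = {k \<in> {K..<Suc n}. L k \<le> n}"
    have "expect n (\<lambda>u. of_bool (\<not> Good u)) \<le>
        expect n (\<lambda>u. \<Sum>k\<in>I. of_bool (\<not> G k (take (L k) u)))"
    proof (rule expect_mono)
      fix u assume u: "u \<in> words n"
      show "of_bool (\<not> Good u) \<le> (\<Sum>k\<in>I. of_bool (\<not> G k (take (L k) u)) :: real)"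
      proof (cases "Good u")
        case False
        then obtain k where "K \<le> k" "L k \<le> n" and G: "\<not> G k (take (L k) u)"
          using u by (auto simp: Good_def words_length)
        then have k: "k \<in> I" using L[of k] by (simp add: I_def)
        show ?thesis
          using G k member_le_sum[of k I "\<lambda>k. of_bool (\<not> G k (take (L k) u)) :: real"]
          by (simp add: I_def False)
      qed (simp add: sum_nonneg)
    qed
    also have "\<dots> = (\<Sum>k\<in>I. expect n (\<lambda>u. of_bool (\<not> G k (take (L k) u))))"
      by (rule expect_sum)
    also have "\<dots> \<le> sum \<beta> I"
    proof (rule sum_mono)
      fix k assume "k \<in> I"
      then have "n = L k + (n - L k)" by (simp add: I_def)
      then have "expect n (\<lambda>u. of_bool (\<not> G k (take (L k) u))) = expect (L k) (\<lambda>u. of_bool (\<not> G k u))"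
        using expect_take[of "L k" "n - L k" "\<lambda>u. of_bool (\<not> G k u)"] by simp
      then show "expect n (\<lambda>u. of_bool (\<not> G k (take (L k) u))) \<le> \<beta> k" using bad[of k] by simp
    qed
    also have "\<dots> \<le> sum \<beta> {K..<Suc n}" by (rule sum_mono2) (auto simp: I_def pos)
    also have "\<dots> < 1" using K[of K "Suc n"] by simp
    finally show "\<exists>v\<in>words n. Good v" using expect_less_ex by fastforce
  next
    fix v n assume "Good v"
    then show "Good (take n v)" by (auto simp: Good_def take_take min_def)
  qed
  then obtain d where d: "\<And>i. d i < b" "\<And>n. Good (map d [0..<n])" by blast
  have "G k (map d [0..<L k])" if "K \<le> k" for k
    using d(2)[of "L k"] that by (auto simp: Good_def)
  then show ?thesis
    using d(1) by (auto simp: eventually_sequentially)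
qed

text \<open>A larger \<lambda> appends letters to the prefix, and each new letter creates at most
  one window; the term \<open>1 / real b ^ k\<close> pays for rounding.\<close>

lemma Z_freq_lipschitz:
  assumes "0 \<le> l" "l \<le> l'"
  shows "\<bar>Z_freq b l j k d - Z_freq b l' j k d\<bar> \<le> (l' - l) + 1 / real b ^ k"
proof -
  define n where "n = nat \<lfloor>l * real b ^ k\<rfloor>"
  define n' where "n' = nat \<lfloor>l' * real b ^ k\<rfloor>"
  have "l * real b ^ k \<le> l' * real b ^ k" using assms by (intro mult_right_mono) auto
  then have le: "n \<le> n'" unfolding n_def n'_def by (intro nat_mono floor_mono)
  have "real n = of_int \<lfloor>l * real b ^ k\<rfloor>" "real n' = of_int \<lfloor>l' * real b ^ k\<rfloor>"
    using assms by (auto simp: n_def n'_def)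
  then have nn: "real n' - real n \<le> (l' - l) * real b ^ k + 1"
    unfolding left_diff_distrib by linarith
  have "[0..<n' + k] = [0..<n + k] @ [n + k..<n' + k]"
    using le upt_add_eq_append[of 0 "n + k" "n' - n"] by (simp add: add.commute)
  then have "map d [0..<n' + k] = map d [0..<n + k] @ map d [n + k..<n' + k]"
    by (simp flip: map_append)
  then have "\<bar>Z_freq b l j k d - Z_freq b l' j k d\<bar> \<le> real (n' - n) / real b ^ k"
    using fraction_diff_append_length[of k j "map d [0..<n + k]" "map d [n + k..<n' + k]"] assms
    by (simp add: Z_freq_eq_fraction n_def n'_def)
  also have "\<dots> \<le> ((l' - l) * real b ^ k + 1) / real b ^ k"
    using nn le by (intro divide_right_mono) auto
  finally show ?thesis using b2 by (simp add: add_divide_distrib)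
qed

text \<open>Frequencies and Poisson weights are Lipschitz in \<lambda>, uniformly in k up to a
  vanishing term, so rational \<lambda> suffice. This leaves countably many conditions, as required
  both for existence and for the Borel class.\<close>

lemma Poisson_generic_iff:
  "Poisson_generic b d \<longleftrightarrow> (\<forall>m q j e. \<forall>\<^sub>F k in sequentially.
     \<bar>Z_freq b (real (Suc m) / real (Suc q)) j k d - poisson j (real (Suc m) / real (Suc q))\<bar> \<le> 1 / real (Suc e))"
  (is "_ \<longleftrightarrow> ?R")
proof
  assume P: "Poisson_generic b d"
  show ?R
  proof (intro allI)
    fix m q j e :: nat
    define l where "l = real (Suc m) / real (Suc q)"
    have "0 < l" by (simp add: l_def)
    then have "(\<lambda>k. Z_freq b l j k d) \<longlonglongrightarrow> poisson j l"
      using P by (simp add: Poisson_generic_def lambda_Poisson_generic_def poisson_def)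
    then have "\<forall>\<^sub>F k in sequentially. dist (Z_freq b l j k d) (poisson j l) < 1 / real (Suc e)"
      by (rule tendstoD) simp
    then show "\<forall>\<^sub>F k in sequentially. \<bar>Z_freq b l j k d - poisson j l\<bar> \<le> 1 / real (Suc e)"
      by eventually_elim (simp add: dist_real_def)
  qed
next
  assume R: ?R
  show "Poisson_generic b d"
    unfolding Poisson_generic_def lambda_Poisson_generic_def poisson_def[symmetric]
  proof (intro allI impI tendstoI)
    fix l :: real and j and e :: real assume "0 < l" "0 < e"
    \<comment> \<open>Four errors below e / 5 are added: r - l for the frequency, r - l for the
      weight, the rounding term and the tolerance at r.\<close>
    obtain r where r: "r \<in> \<rat>" "l < r" "r < l + e / 5"
      using Rats_dense_in_real[of l "l + e / 5"] \<open>0 < e\<close> by auto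
    obtain m n where "n \<noteq> 0" "\<bar>r\<bar> = real m / real n" using Rats_abs_nat_div_natE[OF r(1)] by metis
    then have mn: "r = real m / real n" "0 < m" "0 < n" using r \<open>0 < l\<close> by (auto intro: Nat.gr0I)
    obtain i where i: "1 / real (Suc i) < e / 5" using nat_approx_posE[of "e / 5"] \<open>0 < e\<close> by auto
    have "\<forall>\<^sub>F k in sequentially. \<bar>Z_freq b r j k d - poisson j r\<bar> \<le> 1 / real (Suc i)"
      using R[rule_format, of "m - 1" "n - 1" j i] mn by simp
    moreover have "\<forall>\<^sub>F k in sequentially. real k ^ 0 / real b ^ k < e / 5"
      using tendsto_poly_div_b_pow[of 0] \<open>0 < e\<close> by (intro order_tendstoD) auto
    ultimately show "\<forall>\<^sub>F k in sequentially. dist (Z_freq b l j k d) (poisson j l) < e"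
    proof eventually_elim
      case (elim k)
      have "\<bar>Z_freq b l j k d - Z_freq b r j k d\<bar> \<le> (r - l) + 1 / real b ^ k"
        using r \<open>0 < l\<close> by (intro Z_freq_lipschitz) auto
      moreover have "\<bar>poisson j r - poisson j l\<bar> \<le> r - l"
        using poisson_lipschitz[of l "r - l" j] r \<open>0 < l\<close> by simp
      ultimately show ?case
        using elim i r unfolding dist_real_def by simp
    qed
  qed
qed

text \<open>Stage k imposes tolerance 1 / k for all \<lambda> = m / q and all j with parameters up
  to k, so every fixed triple is eventually covered.\<close>

lemma Poisson_generic_exists: "\<exists>d. (\<forall>i. d i < b) \<and> Poisson_generic b d"
proof -
  define len where "len k m q = nat \<lfloor>real m / real q * real b ^ k\<rfloor> + k" for k m q :: nat
  \<comment> \<open>Long enough for every prefix tested at stage k, since m / q is at most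
    k.\<close>
  define L where "L k = k * b ^ k + k" for k
  define bad where "bad k m q j u \<longleftrightarrow>
      \<bar>fraction k j u - mean_fraction k j (len k m q)\<bar> > 1 / real k" for k m q j u
  define I where "I k = {1..k} \<times> {1..k} \<times> {..k}" for k :: nat
  define G where "G k u \<longleftrightarrow> (\<forall>(m, q, j)\<in>I k. \<not> bad k m q j (take (len k m q) u))" for k u
  have len_le: "len k m q \<le> L k" if "m \<le> k" "1 \<le> q" for k m q
  proof -
    have "real m / real q \<le> real k"
      using that frac_le[of "real k" "real m" 1 "real q"] by simp
    then have "real m / real q * real b ^ k \<le> real (k * b ^ k)"
      using mult_right_mono[of "real m / real q" "real k" "real b ^ k"] by simp
    then have "nat \<lfloor>real m / real q * real b ^ k\<rfloor> \<le> nat \<lfloor>real (k * b ^ k)\<rfloor>"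
      by (intro nat_mono floor_mono)
    also have "\<dots> = k * b ^ k" by (simp only: floor_of_nat nat_int)
    finally show ?thesis by (simp add: len_def L_def)
  qed
  have badp: "expect (L k) (\<lambda>u. of_bool (bad k m q j (take (len k m q) u))) \<le> 8 * (real k ^ 5 / real b ^ k)"
    if "(m, q, j) \<in> I k" for k m q j
  proof -
    have k: "0 < k" "m \<le> k" "1 \<le> q" using that by (auto simp: I_def)
    define n where "n = len k m q"
    have n: "n \<le> L k" using len_le k by (simp add: n_def)
    have "expect (L k) (\<lambda>u. of_bool (bad k m q j (take n u))) = expect n (\<lambda>u. of_bool (bad k m q j u))"
      using expect_take[of n "L k - n" "\<lambda>u. of_bool (bad k m q j u)"] n by simp
    \<comment> \<open>Chebyshev with at most \<open>2 * k * b ^ k\<close> letters, influence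
      \<open>2 * k / b ^ k\<close> of each letter and tolerance 1 / k; this produces the bound
      \<open>8 * k ^ 5 / b ^ k\<close>.\<close>
    also have "\<dots> \<le> real n * (2 * real k / real b ^ k)\<^sup>2 / (1 / real k)\<^sup>2"
      unfolding bad_def mean_fraction_def n_def[symmetric]
      using k by (intro chebyshev_bounded_differences fraction_bounded_differences) auto
    also have "\<dots> \<le> real (L k) * (2 * real k / real b ^ k)\<^sup>2 / (1 / real k)\<^sup>2"
      using n by (intro divide_right_mono mult_right_mono) auto
    also have "\<dots> \<le> (2 * real k * real b ^ k) * (2 * real k / real b ^ k)\<^sup>2 / (1 / real k)\<^sup>2"
    proof (intro divide_right_mono mult_right_mono)
      have "real k * 1 \<le> real k * real b ^ k" using b2 by (intro mult_left_mono) auto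
      then show "real (L k) \<le> 2 * real k * real b ^ k" by (simp add: L_def)
    qed auto
    also have "\<dots> = 8 * (real k ^ 5 / real b ^ k)"
      using k b2 by (simp add: field_simps power2_eq_square eval_nat_numeral)
    finally show ?thesis by (simp add: n_def)
  qed
  have "\<exists>d. (\<forall>i. d i < b) \<and> (\<forall>\<^sub>F k in sequentially. G k (map d [0..<L k]))"
  proof (rule borel_cantelli_digits)
    fix k
    have finI: "finite (I k)" by (simp add: I_def)
    have "expect (L k) (\<lambda>u. of_bool (\<not> G k u)) \<le>
        expect (L k) (\<lambda>u. \<Sum>(m, q, j)\<in>I k. of_bool (bad k m q j (take (len k m q) u)))"
    proof (rule expect_mono)
      fix u
      show "of_bool (\<not> G k u) \<le> (\<Sum>(m, q, j)\<in>I k. of_bool (bad k m q j (take (len k m q) u)) :: real)"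
      proof (cases "G k u")
        case False
        then obtain m q j where "(m, q, j) \<in> I k" "bad k m q j (take (len k m q) u)"
          by (auto simp: G_def)
        then show ?thesis
          using member_le_sum[of "(m, q, j)" "I k"
              "\<lambda>(m, q, j). of_bool (bad k m q j (take (len k m q) u)) :: real"] finI
          by (auto simp: False split: prod.splits)
      qed (simp add: sum_nonneg split: prod.splits)
    qed
    also have "\<dots> = (\<Sum>(m, q, j)\<in>I k. expect (L k) (\<lambda>u. of_bool (bad k m q j (take (len k m q) u))))"
      by (simp add: expect_sum case_prod_unfold)
    also have "\<dots> \<le> (\<Sum>(m, q, j)\<in>I k. 8 * (real k ^ 5 / real b ^ k))"
      by (rule sum_mono) (auto simp only: split_paired_all case_prod_conv intro!: badp)
    \<comment> \<open>The number of triples at stage k is only polynomial in k, so the union bound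
      stays summable.\<close>
    also have "\<dots> = 8 * (real (k * (k * Suc k)) * (real k ^ 5 / real b ^ k))"
      by (simp add: I_def card_cartesian_product)
    also have "\<dots> = 8 * (real k ^ 8 / real b ^ k) + 8 * (real k ^ 7 / real b ^ k)"
      using b2 by (simp add: field_simps eval_nat_numeral)
    finally show "expect (L k) (\<lambda>u. of_bool (\<not> G k u)) \<le>
        8 * (real k ^ 8 / real b ^ k) + 8 * (real k ^ 7 / real b ^ k)" .
  next
    show "summable (\<lambda>k. 8 * (real k ^ 8 / real b ^ k) + 8 * (real k ^ 7 / real b ^ k))"
      by (intro summable_add summable_mult summable_poly_div_b_pow)
  qed (simp add: L_def)
  then obtain d where d: "\<And>i. d i < b" and G: "\<forall>\<^sub>F k in sequentially. G k (map d [0..<L k])"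
    by blast
  have "Poisson_generic b d"
    unfolding Poisson_generic_iff
  proof (intro allI)
    fix m q j e :: nat
    define l where "l = real (Suc m) / real (Suc q)"
    define \<epsilon> where "\<epsilon> = 1 / real (Suc e)"
    have l: "0 \<le> l" by (simp add: l_def)
    have "\<forall>\<^sub>F k in sequentially. \<bar>mean_fraction k j (nat \<lfloor>l * real b ^ k\<rfloor> + k) - poisson j l\<bar> < 1 / real (Suc e) / 2"
      using tendstoD[OF tendsto_mean_fraction[OF l, of j], of "1 / real (Suc e) / 2"]
      by (simp add: dist_real_def)
    moreover have "\<forall>\<^sub>F k in sequentially. 1 / real k < 1 / real (Suc e) / 2"
      using lim_1_over_n by (intro order_tendstoD) auto
    ultimately show "\<forall>\<^sub>F k in sequentially. \<bar>Z_freq b l j k d - poisson j l\<bar> \<le> 1 / real (Suc e)"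
      using G eventually_ge_at_top[of "Suc m + Suc q + j"]
    proof eventually_elim
      case (elim k)
      have k: "Suc m \<le> k" "Suc q \<le> k" "j \<le> k" using elim(4) by auto
      define n where "n = nat \<lfloor>l * real b ^ k\<rfloor> + k"
      have n: "len k (Suc m) (Suc q) = n" by (simp add: len_def n_def l_def)
      have "n \<le> L k" using len_le[of "Suc m" k "Suc q"] k n by simp
      then have "take n (map d [0..<L k]) = map d [0..<n]" by (simp add: take_map)
      moreover have "(Suc m, Suc q, j) \<in> I k" using k by (auto simp: I_def)
      ultimately have "\<not> bad k (Suc m) (Suc q) j (map d [0..<n])"
        using elim(3) n by (force simp: G_def)
      then have "\<bar>Z_freq b l j k d - mean_fraction k j n\<bar> \<le> 1 / real k"
        using n by (simp add: bad_def Z_freq_eq_fraction[OF l] n_def)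
      then show ?case using elim(1,2) unfolding n_def[symmetric] \<epsilon>_def[symmetric] by linarith
    qed
  qed
  then show ?thesis using d by blast
qed

end

section \<open>Erasing digits\<close>

context base
begin

text \<open>Within the scale from \<open>b\<^sup>s\<close> to \<open>b\<^sup>s\<^sup>+\<^sup>1\<close> the digits \<open>x\<close> are erased on an initial
  stretch of relative length about \<open>1 / (\<alpha> s + 2)\<close>. The digits 1 keep the expansion from
  terminating, and the leading 0 keeps its value below 1.\<close>

definition erase :: "(nat \<Rightarrow> nat) \<Rightarrow> (nat \<Rightarrow> nat) \<Rightarrow> nat \<Rightarrow> nat" where
  "erase x \<alpha> n =
    (if \<exists>s. n + 1 = b ^ Suc s then 1
     else if n = 0 \<or> (\<exists>s. b ^ s \<le> n \<and> n < b ^ s + b ^ s div (\<alpha> s + 2)) then 0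
     else x n)"

lemma less_b_pow: "s < b ^ s"
  using b2 power_gt_expt[of b s] by auto

lemma erase_less: "(\<And>i. x i < b) \<Longrightarrow> erase x \<alpha> n < b"
  using b2 by (auto simp: erase_def)

lemma erase_0: "erase x \<alpha> 0 = 0"
proof -
  have "1 \<noteq> b ^ Suc s" for s using less_b_pow[of "Suc s"] by linarith
  then show ?thesis by (auto simp: erase_def)
qed

lemma infinite_erase: "infinite {n. erase x \<alpha> n \<noteq> 0}"
proof -
  have pos: "0 < b ^ Suc s" for s using b2 by simp
  have "inj (\<lambda>s. b ^ Suc s - 1)"
  proof (rule injI)
    fix s t assume "b ^ Suc s - 1 = b ^ Suc t - 1"
    then have "b ^ Suc s = b ^ Suc t" using pos[of s] pos[of t] by linarith
    then show "s = t" using b2 by (simp add: power_inject_exp del: power_Suc)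
  qed
  then have "infinite (range (\<lambda>s. b ^ Suc s - 1))" by (rule range_inj_infinite)
  moreover have "b ^ Suc s - 1 + 1 = b ^ Suc s" for s using pos[of s] by linarith
  then have "erase x \<alpha> (b ^ Suc s - 1) = 1" for s
    unfolding erase_def by (metis (no_types, lifting))
  then have "range (\<lambda>s. b ^ Suc s - 1) \<subseteq> {n. erase x \<alpha> n \<noteq> 0}"
    by (auto simp del: power_Suc)
  ultimately show ?thesis using infinite_super by blast
qed

text \<open>From \<open>b ^ s \<le> n\<close> follows \<open>s \<le> n\<close>, so digit n reads
  only finitely many values of \<alpha>. This makes the reduction continuous.\<close>

lemma erase_cong:
  assumes "\<And>s. s \<le> n \<Longrightarrow> \<alpha> s = \<alpha>' s"
  shows "erase x \<alpha> n = erase x \<alpha>' n"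
proof -
  have "s \<le> n" if "b ^ s \<le> n" for s using that less_b_pow[of s] by linarith
  then have "(b ^ s \<le> n \<and> n < b ^ s + b ^ s div (\<alpha> s + 2)) \<longleftrightarrow>
      (b ^ s \<le> n \<and> n < b ^ s + b ^ s div (\<alpha>' s + 2))" for s
    using assms[of s] by auto
  then show ?thesis by (simp add: erase_def)
qed

text \<open>The erased stretch has length at most half of \<open>b ^ s\<close>, so it does not reach
  the forced digits 1, which sit just before powers of b.\<close>

lemma erase_window:
  assumes "b ^ s \<le> n" "n < b ^ s + b ^ s div (\<alpha> s + 2)"
  shows "erase x \<alpha> n = 0"
proof -
  have "b ^ s div (\<alpha> s + 2) \<le> b ^ s div 2" by (rule div_le_mono2) auto
  moreover have "b ^ s div 2 < b ^ s" "2 * b ^ s \<le> b * b ^ s" using b2 by auto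
  ultimately have n: "b ^ s < n + 1" "n + 1 < b ^ Suc s"
    using assms unfolding power_Suc by linarith+
  have "n + 1 \<noteq> b ^ Suc t" for t
  proof
    assume "n + 1 = b ^ Suc t"
    with n have "s < Suc t" "Suc t < Suc s"
      by (metis (no_types) power_less_imp_less_exp b2 less_le_trans one_less_numeral_iff semiring_norm(76))+
    then show False by simp
  qed
  then show ?thesis using assms by (auto simp: erase_def)
qed

lemma sum_b_pow_le: "(\<Sum>s<m. real b ^ s) \<le> real b ^ m"
proof (induction m)
  case (Suc m)
  have "2 * real b ^ m \<le> real b * real b ^ m" using b2 by (intro mult_right_mono) auto
  then show ?case using Suc by simp
qed simp

text \<open>The weights below m sum to at most \<open>b ^ m\<close>, and those of any fixed initial
  segment are negligible against it.\<close>

lemma tendsto_geometric_average: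
  assumes "a \<longlonglongrightarrow> (0 :: real)"
  shows "(\<lambda>m. (\<Sum>s<m. real b ^ s * a s) / real b ^ m) \<longlonglongrightarrow> 0"
proof (rule tendstoI)
  fix e :: real assume "0 < e"
  then obtain M where M: "\<And>s. s \<ge> M \<Longrightarrow> \<bar>a s\<bar> < e / 2"
    using LIMSEQ_D[OF assms, of "e / 2"] by auto
  define C where "C = (\<Sum>s<M. real b ^ s * \<bar>a s\<bar>)"
  have C0: "0 \<le> C" by (simp add: C_def sum_nonneg)
  have "(\<lambda>m. C * (real m ^ 0 / real b ^ m)) \<longlonglongrightarrow> C * 0"
    by (intro tendsto_intros tendsto_poly_div_b_pow)
  then have "\<forall>\<^sub>F m in sequentially. C / real b ^ m < e / 2"
    using \<open>0 < e\<close> by (intro order_tendstoD) auto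
  then show "\<forall>\<^sub>F m in sequentially. dist ((\<Sum>s<m. real b ^ s * a s) / real b ^ m) 0 < e"
  proof eventually_elim
    case (elim m)
    have "\<bar>\<Sum>s<m. real b ^ s * a s\<bar> \<le> (\<Sum>s<m. real b ^ s * \<bar>a s\<bar>)"
      by (rule order_trans[OF sum_abs]) (simp add: abs_mult)
    also have "\<dots> \<le> (\<Sum>s<m. (if s < M then real b ^ s * \<bar>a s\<bar> else 0) + e / 2 * real b ^ s)"
    proof (rule sum_mono)
      fix s
      have "\<bar>a s\<bar> * real b ^ s \<le> e / 2 * real b ^ s" if "M \<le> s"
        using M[OF that] by (intro mult_right_mono) auto
      then show "real b ^ s * \<bar>a s\<bar> \<le> (if s < M then real b ^ s * \<bar>a s\<bar> else 0) + e / 2 * real b ^ s"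
        using \<open>0 < e\<close> by (auto simp: mult.commute)
    qed
    also have "\<dots> = (\<Sum>s\<in>{..<m} \<inter> {..<M}. real b ^ s * \<bar>a s\<bar>) + e / 2 * (\<Sum>s<m. real b ^ s)"
      by (simp add: sum.distrib sum_distrib_left sum.If_cases lessThan_def)
    also have "\<dots> \<le> C + e / 2 * real b ^ m"
      unfolding C_def using sum_b_pow_le[of m] \<open>0 < e\<close>
      by (intro add_mono mult_left_mono sum_mono2) auto
    finally have "\<bar>\<Sum>s<m. real b ^ s * a s\<bar> / real b ^ m \<le> (C + e / 2 * real b ^ m) / real b ^ m"
      by (intro divide_right_mono) auto
    also have "\<dots> = C / real b ^ m + e / 2" using b2 by (simp add: add_divide_distrib)
    finally have "\<bar>\<Sum>s<m. real b ^ s * a s\<bar> / real b ^ m < e" using elim by linarith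
    then show ?case by (simp add: dist_real_def)
  qed
qed

lemma Poisson_generic_perturb:
  assumes "Poisson_generic b x"
    and "\<And>l j. 0 < l \<Longrightarrow> (\<lambda>k. Z_freq b l j k y - Z_freq b l j k x) \<longlonglongrightarrow> 0"
  shows "Poisson_generic b y"
  unfolding Poisson_generic_def lambda_Poisson_generic_def
proof (intro allI impI)
  fix l :: real and j assume "0 < l"
  then have "(\<lambda>k. Z_freq b l j k x) \<longlonglongrightarrow> exp (- l) * l ^ j / fact j"
    using assms(1) by (simp add: Poisson_generic_def lambda_Poisson_generic_def)
  from tendsto_add[OF assms(2)[OF \<open>0 < l\<close>, of j] this]
  show "(\<lambda>k. Z_freq b l j k y) \<longlonglongrightarrow> exp (- l) * l ^ j / fact j" by simp
qed

text \<open>The windows that touch a changed digit number at most 2 k per scale plus the lengths of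
  the erased stretches. Divided by \<open>b ^ k\<close>, the former vanish and the latter form a
  geometric average of a null sequence.\<close>

lemma Poisson_generic_erase:
  assumes "Poisson_generic b x" "filterlim \<alpha> at_top sequentially"
  shows "Poisson_generic b (erase x \<alpha>)"
proof (rule Poisson_generic_perturb[OF assms(1)])
  fix l :: real and j :: nat assume l: "0 < l"
  \<comment> \<open>Since \<open>k \<le> b ^ k\<close>, the prefix then has length at most
    \<open>b ^ (k + c)\<close> and meets only scales below k + c.\<close>
  obtain c where c: "l + 1 \<le> real b ^ c"
    using real_arch_pow[of "real b" "l + 1"] b2 by (auto intro: less_imp_le)
  define a where "a s = 1 / real (\<alpha> s + 2)" for s
  define A where "A k = (\<Sum>s<k + c. real b ^ s * a s)" for k
  have "filterlim (\<lambda>s. real (\<alpha> s + 2)) at_top sequentially"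
    using filterlim_compose[OF filterlim_real_sequentially filterlim_add_const_nat_at_top[of 2]]
      filterlim_compose assms(2) by fastforce
  then have "a \<longlonglongrightarrow> 0"
    unfolding a_def[abs_def] by (intro tendsto_divide_0[OF tendsto_const] filterlim_at_top_imp_at_infinity)
  then have "(\<lambda>k. A k / real b ^ (k + c)) \<longlonglongrightarrow> 0"
    unfolding A_def by (rule LIMSEQ_ignore_initial_segment[OF tendsto_geometric_average])
  then have "(\<lambda>k. real b ^ c * (A k / real b ^ (k + c))) \<longlonglongrightarrow> real b ^ c * 0"
    by (intro tendsto_intros)
  moreover have "real b ^ c * (A k / real b ^ (k + c)) = A k / real b ^ k" for k
    using b2 by (simp add: power_add)
  ultimately have A0: "(\<lambda>k. A k / real b ^ k) \<longlonglongrightarrow> 0" by simp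

  show "(\<lambda>k. Z_freq b l j k (erase x \<alpha>) - Z_freq b l j k x) \<longlonglongrightarrow> 0"
  proof (rule Lim_null_comparison)
    show "\<forall>\<^sub>F k in sequentially. norm (Z_freq b l j k (erase x \<alpha>) - Z_freq b l j k x) \<le>
        2 * (real k ^ 0 / real b ^ k + 2 * (real k ^ 2 / real b ^ k) + 2 * real c * (real k ^ 1 / real b ^ k)
          + A k / real b ^ k)"
    proof (rule always_eventually, rule allI)
      fix k
      define n where "n = nat \<lfloor>l * real b ^ k\<rfloor> + k"
      \<comment> \<open>\<open>W1\<close> collects the starts of windows containing the forced digit
        1 before \<open>b ^ Suc s\<close>, \<open>W2\<close> those meeting the erased stretch of
        scale s; the start 0 accounts for the leading digit.\<close>
      define W1 where "W1 s = {b ^ Suc s - k..<b ^ Suc s}" for s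
      define W2 where "W2 s = {b ^ s - k..<b ^ s + b ^ s div (\<alpha> s + 2)}" for s
      define D where "D = {0} \<union> (\<Union>s<k + c. W1 s \<union> W2 s)"
      have "real n \<le> l * real b ^ k + real k"
        using of_int_floor_le[of "l * real b ^ k"] l by (simp add: n_def)
      also have "\<dots> \<le> l * real b ^ k + real b ^ k"
        using less_b_pow[of k] by (simp flip: of_nat_power)
      also have "\<dots> = (l + 1) * real b ^ k" by (simp add: algebra_simps)
      also have "\<dots> \<le> real b ^ c * real b ^ k" using c by (intro mult_right_mono) auto
      also have "\<dots> = real (b ^ (k + c))" by (simp add: power_add mult.commute)
      finally have n: "n \<le> b ^ (k + c)" by (simp only: of_nat_le_iff)
      have b1: "1 < b" using b2 by simp
      have "\<bar>fraction k j (map (erase x \<alpha>) [0..<n]) - fraction k j (map x [0..<n])\<bar>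
          \<le> 2 * real (card D) / real b ^ k"
      proof (rule fraction_diff_positions)
        fix p assume p: "p \<notin> D" "p + k \<le> length (map (erase x \<alpha>) [0..<n])"
        have "erase x \<alpha> i = x i" if i: "p \<le> i" "i < p + k" for i
        proof -
          have "i < n" using i p by simp
          have "i + 1 \<noteq> b ^ Suc s" for s
          proof
            assume s: "i + 1 = b ^ Suc s"
            then have "b ^ Suc s \<le> b ^ (k + c)" using n \<open>i < n\<close> by simp
            then have "Suc s \<le> k + c" using b1 power_le_imp_le_exp by blast
            moreover have "p \<in> W1 s" using s i by (auto simp: W1_def)
            ultimately show False using p(1) by (auto simp: D_def)
          qed
          moreover have "\<not> (b ^ s \<le> i \<and> i < b ^ s + b ^ s div (\<alpha> s + 2))" for s
          proof
            assume s: "b ^ s \<le> i \<and> i < b ^ s + b ^ s div (\<alpha> s + 2)"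
            then have "b ^ s < b ^ (k + c)" using n \<open>i < n\<close> by simp
            then have "s < k + c" using b1 power_less_imp_less_exp by blast
            moreover have "p \<in> W2 s" using s i by (auto simp: W2_def)
            ultimately show False using p(1) by (auto simp: D_def)
          qed
          moreover have "i \<noteq> 0" using i p(1) by (auto simp: D_def)
          ultimately show ?thesis unfolding erase_def by meson
        qed
        then show "take k (drop p (map (erase x \<alpha>) [0..<n])) = take k (drop p (map x [0..<n]))"
          using p(2) by (intro nth_equalityI) auto
      qed (auto simp: D_def W1_def W2_def)
      moreover have "real (card D) \<le> 1 + (\<Sum>s<k + c. real (card (W1 s \<union> W2 s)))"
      proof -
        have "card D \<le> card {0::nat} + card (\<Union>s<k + c. W1 s \<union> W2 s)"
          unfolding D_def by (rule card_Un_le)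
        also have "\<dots> \<le> 1 + (\<Sum>s<k + c. card (W1 s \<union> W2 s))"
          by (intro add_mono card_UN_le) auto
        finally have "real (card D) \<le> real (1 + (\<Sum>s<k + c. card (W1 s \<union> W2 s)))"
          by (simp only: of_nat_le_iff)
        then show ?thesis by simp
      qed
      moreover have "(\<Sum>s<k + c. real (card (W1 s \<union> W2 s))) \<le> (\<Sum>s<k + c. 2 * real k + real b ^ s * a s)"
      proof (rule sum_mono)
        fix s
        have "card (W1 s \<union> W2 s) \<le> card (W1 s) + card (W2 s)" by (rule card_Un_le)
        also have "\<dots> \<le> 2 * k + b ^ s div (\<alpha> s + 2)" by (auto simp: W1_def W2_def)
        finally have "real (card (W1 s \<union> W2 s)) \<le> 2 * real k + real (b ^ s div (\<alpha> s + 2))"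
          by (simp flip: of_nat_mult of_nat_add)
        also have "real (b ^ s div (\<alpha> s + 2)) \<le> real b ^ s * a s"
          using of_nat_div_le_of_nat[where 'a = real, of "b ^ s" "\<alpha> s + 2"] by (simp add: a_def)
        finally show "real (card (W1 s \<union> W2 s)) \<le> 2 * real k + real b ^ s * a s" by simp
      qed
      moreover have "(\<Sum>s<k + c. 2 * real k + real b ^ s * a s) = 2 * real k * (real k + real c) + A k"
        by (simp add: sum.distrib A_def algebra_simps)
      ultimately have "\<bar>fraction k j (map (erase x \<alpha>) [0..<n]) - fraction k j (map x [0..<n])\<bar>
          \<le> 2 * (1 + 2 * real k * (real k + real c) + A k) / real b ^ k"
        by (elim order_trans) (intro divide_right_mono, auto)
      also have "\<dots> = 2 * (real k ^ 0 / real b ^ k + 2 * (real k ^ 2 / real b ^ k)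
          + 2 * real c * (real k ^ 1 / real b ^ k) + A k / real b ^ k)"
        by (simp add: add_divide_distrib algebra_simps power2_eq_square)
      finally show "norm (Z_freq b l j k (erase x \<alpha>) - Z_freq b l j k x) \<le>
          2 * (real k ^ 0 / real b ^ k + 2 * (real k ^ 2 / real b ^ k) + 2 * real c * (real k ^ 1 / real b ^ k)
            + A k / real b ^ k)"
        using l by (simp add: Z_freq_eq_fraction n_def)
    qed
    have "(\<lambda>k. 2 * (real k ^ 0 / real b ^ k + 2 * (real k ^ 2 / real b ^ k)
        + 2 * real c * (real k ^ 1 / real b ^ k) + A k / real b ^ k)) \<longlonglongrightarrow> 2 * (0 + 2 * 0 + 2 * real c * 0 + 0)"
      by (intro tendsto_intros tendsto_poly_div_b_pow A0)
    then show "(\<lambda>k. 2 * (real k ^ 0 / real b ^ k + 2 * (real k ^ 2 / real b ^ k)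
        + 2 * real c * (real k ^ 1 / real b ^ k) + A k / real b ^ k)) \<longlonglongrightarrow> 0" by simp
  qed
qed

text \<open>All new windows start after \<open>b ^ k\<close>, at most the length of the erased
  stretch further on. Those that fit inside the stretch read the zero word, and at most k do not
  fit, so at most k + 1 distinct words change their count.\<close>

lemma erase_Z_freq_diff:
  assumes "\<alpha> k = i"
  shows "\<bar>Z_freq b 1 j k (erase x \<alpha>) - Z_freq b (1 + 1 / real (i + 2)) j k (erase x \<alpha>)\<bar>
    \<le> (real k + 1) / real b ^ k"
proof -
  define y where "y = erase x \<alpha>"
  define W where "W = b ^ k div (i + 2)"
  have 1: "nat \<lfloor>1 * real b ^ k\<rfloor> = b ^ k" by (simp flip: of_nat_power)
  have "(1 + 1 / real (i + 2)) * real b ^ k = real (b ^ k) + real (b ^ k) / real (i + 2)"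
    by (simp add: algebra_simps)
  then have "\<lfloor>(1 + 1 / real (i + 2)) * real b ^ k\<rfloor> = int (b ^ k) + int W"
    using int_add_floor[of "int (b ^ k)" "real (b ^ k) / real (i + 2)"]
    unfolding W_def floor_divide_of_nat_eq of_int_of_nat_eq by metis
  then have 2: "nat \<lfloor>(1 + 1 / real (i + 2)) * real b ^ k\<rfloor> = b ^ k + W"
    by (simp only: nat_int of_nat_add[symmetric])
  let ?u = "map y [0..<b ^ k + k]"
  let ?v = "map y [b ^ k + k..<b ^ k + W + k]"
  have "[0..<b ^ k + W + k] = [0..<b ^ k + k] @ [b ^ k + k..<b ^ k + W + k]"
    using upt_add_eq_append[of 0 "b ^ k + k" W] by (simp add: ac_simps)
  then have uv: "map y [0..<b ^ k + W + k] = ?u @ ?v" by (simp flip: map_append)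
  let ?f = "\<lambda>p. take k (drop p (?u @ ?v))"
  let ?P = "{p. length ?u < p + k \<and> p + k \<le> length ?u + length ?v}"
  let ?Q = "{p. b ^ k + W < p + k \<and> p + k \<le> b ^ k + W + k}"
  have finQ: "finite ?Q" by (rule finite_subset[of _ "{..b ^ k + W + k}"]) auto
  have "?f ` ?P \<subseteq> insert (replicate k 0) (?f ` ?Q)"
  proof
    fix w assume "w \<in> ?f ` ?P"
    then obtain p where p: "b ^ k < p" "p \<le> b ^ k + W" "w = ?f p" by auto
    show "w \<in> insert (replicate k 0) (?f ` ?Q)"
    proof (cases "p + k \<le> b ^ k + W")
      case True
      have "w = replicate k 0"
        unfolding p(3) uv[symmetric]
      proof (rule nth_equalityI)
        show "length (take k (drop p (map y [0..<b ^ k + W + k]))) = length (replicate k 0)"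
          using p by simp
        fix t assume "t < length (take k (drop p (map y [0..<b ^ k + W + k])))"
        then have "t < k" by simp
        moreover have "y (p + t) = 0"
          unfolding y_def by (rule erase_window[of k]) (use p True \<open>t < k\<close> assms in \<open>auto simp: W_def\<close>)
        ultimately show "take k (drop p (map y [0..<b ^ k + W + k])) ! t = replicate k 0 ! t"
          using p by simp
      qed
      then show ?thesis by simp
    next
      case False
      then have "p \<in> ?Q" using p by simp
      then show ?thesis unfolding p(3) by blast
    qed
  qed
  then have "card (?f ` ?P) \<le> card (insert (replicate k 0) (?f ` ?Q))"
    using finQ by (intro card_mono) auto
  also have "\<dots> \<le> Suc (card (?f ` ?Q))" using card_insert_le_m1 finQ by (simp add: card_insert_if)
  also have "\<dots> \<le> Suc k"
    using card_image_le[OF finQ, of ?f] card_shifted_interval[of "b ^ k + W" k k] by simp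
  finally have card: "card (?f ` ?P) \<le> Suc k" .
  have "\<bar>fraction k j ?u - fraction k j (?u @ ?v)\<bar> \<le> real (card (?f ` ?P)) / real b ^ k"
    by (rule fraction_diff_append)
  also have "\<dots> \<le> (real k + 1) / real b ^ k"
    using card by (intro divide_right_mono) auto
  finally have "\<bar>fraction k j ?u - fraction k j (map y [0..<b ^ k + W + k])\<bar> \<le> (real k + 1) / real b ^ k"
    unfolding uv .
  moreover have "Z_freq b 1 j k y = fraction k j ?u"
    using Z_freq_eq_fraction[of 1 j k y] unfolding 1 by simp
  moreover have "Z_freq b (1 + 1 / real (i + 2)) j k y = fraction k j (map y [0..<b ^ k + W + k])"
    using Z_freq_eq_fraction[of "1 + 1 / real (i + 2)" j k y] unfolding 2 by simp
  ultimately show ?thesis by (simp add: y_def)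
qed

text \<open>For j = 0 genericity demands two different limits \<open>exp (- 1)\<close> and
  \<open>exp (- l)\<close>, but by \<open>erase_Z_freq_diff\<close> the two frequencies merge along
  the infinitely many k with \<open>\<alpha> k = i\<close>.\<close>

lemma not_Poisson_generic_erase:
  assumes "infinite {s. \<alpha> s = i}"
  shows "\<not> Poisson_generic b (erase x \<alpha>)"
proof
  assume P: "Poisson_generic b (erase x \<alpha>)"
  define l where "l = 1 + 1 / real (i + 2)"
  define dz where "dz k = Z_freq b 1 0 k (erase x \<alpha>) - Z_freq b l 0 k (erase x \<alpha>)" for k
  define \<delta> where "\<delta> = exp (- 1) - exp (- l)"
  have l: "1 < l" by (simp add: l_def)
  then have "0 < \<delta>" by (simp add: \<delta>_def)
  have "(\<lambda>k. Z_freq b 1 0 k (erase x \<alpha>)) \<longlonglongrightarrow> exp (- 1)"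
    using P[unfolded Poisson_generic_def lambda_Poisson_generic_def, rule_format, of 1 0] by simp
  moreover have "(\<lambda>k. Z_freq b l 0 k (erase x \<alpha>)) \<longlonglongrightarrow> exp (- l)"
    using P[unfolded Poisson_generic_def lambda_Poisson_generic_def, rule_format, of l 0] l by simp
  ultimately have "dz \<longlonglongrightarrow> \<delta>" unfolding dz_def \<delta>_def by (rule tendsto_diff)
  moreover have "(\<lambda>k. real k ^ 1 / real b ^ k + real k ^ 0 / real b ^ k) \<longlonglongrightarrow> 0 + 0"
    by (intro tendsto_add tendsto_poly_div_b_pow)
  ultimately have "(\<lambda>k. dz k - (real k ^ 1 / real b ^ k + real k ^ 0 / real b ^ k)) \<longlonglongrightarrow> \<delta> - (0 + 0)"
    by (rule tendsto_diff)
  then have "\<forall>\<^sub>F k in sequentially. 0 < dz k - (real k ^ 1 / real b ^ k + real k ^ 0 / real b ^ k)"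
    using \<open>0 < \<delta>\<close> by (intro order_tendstoD) auto
  then obtain N where N: "\<And>k. N \<le> k \<Longrightarrow> (real k + 1) / real b ^ k < dz k"
    by (auto simp: eventually_sequentially add_divide_distrib)
  obtain k where "N \<le> k" "\<alpha> k = i"
    using assms unfolding infinite_nat_iff_unbounded_le by auto
  then show False
    using N[of k] erase_Z_freq_diff[of \<alpha> k i 0 x] by (simp add: dz_def l_def)
qed

end

section \<open>Expansions and the upper bound\<close>

lemma Pi0_Inter_countable:
  fixes F :: "'i::countable \<Rightarrow> 'a set"
  assumes "\<And>i. Sigma0 X n (F i)"
  shows "Pi0 X (Suc n) (\<Inter>i. F i)"
proof -
  have "(\<Inter>i. F i) = (\<Inter>k. F (from_nat k))"
    by auto (metis from_nat_to_nat)
  then show ?thesis using assms by (simp add: Pi0_Inter)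
qed

section \<open>Base-b expansions and half-open cells\<close>

context base
begin

text \<open>Horner's scheme for the integer with base-b digits \<open>d 0\<close>, ...,
  \<open>d (n - 1)\<close>.\<close>

primrec prefix_value :: "(nat \<Rightarrow> nat) \<Rightarrow> nat \<Rightarrow> nat" where
  "prefix_value d 0 = 0"
| "prefix_value d (Suc n) = b * prefix_value d n + d n"

lemma sum_digits_eq: "(\<Sum>j<n. real (d j) / real b ^ Suc j) = real (prefix_value d n) / real b ^ n"
  using b2 by (induction n) (auto simp: field_simps)

lemma prefix_value_upper:
  assumes "\<And>j. d j < b"
  shows "prefix_value d (n + m) + 1 \<le> (prefix_value d n + 1) * b ^ m"
proof (induction m)
  case (Suc m)
  have "prefix_value d (n + Suc m) + 1 \<le> b * (prefix_value d (n + m) + 1)"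
    using assms[of "n + m"] by simp
  also have "\<dots> \<le> b * ((prefix_value d n + 1) * b ^ m)" using Suc by (rule mult_le_mono2)
  finally show ?case by (simp add: algebra_simps)
qed simp

text \<open>The lower bound is strict because a nonzero digit still follows; the upper one is not,
  because all following digits may be b - 1.\<close>

lemma is_expansion_bounds:
  assumes "is_expansion b d x"
  shows "real (prefix_value d n) < x * real b ^ n" "x * real b ^ n \<le> real (prefix_value d n) + 1"
proof -
  let ?f = "\<lambda>j. real (d j) / real b ^ Suc j"
  have d: "\<And>j. d j < b" and inf: "infinite {j. d j \<noteq> 0}" and s: "?f sums x"
    using assms by (auto simp: is_expansion_def)
  obtain i where i: "n \<le> i" "d i \<noteq> 0"
    using inf unfolding infinite_nat_iff_unbounded_le by blast
  have "sum ?f {..<n} < suminf ?f"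
  proof (rule sum_less_suminf2)
    show "summable ?f" using s by (rule sums_summable)
    show "0 < ?f i" using i b2 by simp
  qed (use i in auto)
  then show "real (prefix_value d n) < x * real b ^ n"
    using s b_pow_pos[of n] unfolding sum_digits_eq by (simp add: sums_iff pos_divide_less_eq)
  have "x \<le> (real (prefix_value d n) + 1) / real b ^ n"
  proof (rule LIMSEQ_le_const2)
    show "(\<lambda>m. sum ?f {..<m}) \<longlonglongrightarrow> x" using s by (simp add: sums_def)
    show "\<exists>N. \<forall>m\<ge>N. sum ?f {..<m} \<le> (real (prefix_value d n) + 1) / real b ^ n"
    proof (intro exI[of _ n] allI impI)
      fix m assume "n \<le> m"
      then obtain t where m: "m = n + t" using le_Suc_ex by blast
      have "real (prefix_value d m + 1) \<le> real ((prefix_value d n + 1) * b ^ t)"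
        using prefix_value_upper[of d n t] d m by (simp only: of_nat_le_iff)
      then have "real (prefix_value d m) \<le> (real (prefix_value d n) + 1) * real b ^ t"
        by (simp add: algebra_simps)
      then have "real (prefix_value d m) / real b ^ m \<le> (real (prefix_value d n) + 1) * real b ^ t / real b ^ m"
        by (intro divide_right_mono) auto
      also have "\<dots> = (real (prefix_value d n) + 1) / real b ^ n"
        using b2 by (simp add: m power_add)
      finally show "sum ?f {..<m} \<le> (real (prefix_value d n) + 1) / real b ^ n"
        by (simp only: sum_digits_eq)
    qed
  qed
  then show "x * real b ^ n \<le> real (prefix_value d n) + 1"
    using b_pow_pos[of n] by (simp add: pos_le_divide_eq)
qed

text \<open>For \<open>x > 0\<close> the cell \<open>c\<close> of level \<open>n\<close> is determined by \<open>c < x b\<^sup>n \<le> c + 1\<close>.\<close>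

definition cell :: "nat \<Rightarrow> real \<Rightarrow> nat" where
  "cell n x = nat (\<lceil>x * real b ^ n\<rceil> - 1)"

definition digit :: "real \<Rightarrow> nat \<Rightarrow> nat" where
  "digit x n = cell (Suc n) x - b * cell n x"

lemma cell_eqI:
  assumes "real c < x * real b ^ n" "x * real b ^ n \<le> real c + 1"
  shows "cell n x = c"
proof -
  have "\<lceil>x * real b ^ n\<rceil> = int c + 1" using assms by (intro ceiling_unique) auto
  then show ?thesis by (simp add: cell_def)
qed

lemma cell_bounds:
  assumes "0 < x"
  shows "real (cell n x) < x * real b ^ n" "x * real b ^ n \<le> real (cell n x) + 1"
proof -
  have "0 < \<lceil>x * real b ^ n\<rceil>" using assms b_pow_pos[of n] by simp
  then have "real (cell n x) = of_int \<lceil>x * real b ^ n\<rceil> - 1" by (simp add: cell_def)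
  then show "real (cell n x) < x * real b ^ n" "x * real b ^ n \<le> real (cell n x) + 1"
    by linarith+
qed

text \<open>The bounds identify every prefix value with a cell number, which depends on x
  only.\<close>

lemma is_expansion_unique:
  assumes "is_expansion b d x"
  shows "d = digit x"
proof
  fix n
  have "cell m x = prefix_value d m" for m
    using is_expansion_bounds[OF assms] by (intro cell_eqI)
  then show "d n = digit x n" by (simp add: digit_def)
qed

lemma cell_Suc_bounds:
  assumes "0 < x"
  shows "b * cell n x \<le> cell (Suc n) x" "cell (Suc n) x < b * cell n x + b"
proof -
  have "real b * real (cell n x) < real b * (x * real b ^ n)"
    using cell_bounds(1)[OF assms, of n] b2 by (intro mult_strict_left_mono) auto
  also have "\<dots> = x * real b ^ Suc n" by simp
  also have "\<dots> \<le> real (cell (Suc n) x) + 1" by (rule cell_bounds(2)[OF assms])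
  finally have "real (b * cell n x) < real (cell (Suc n) x + 1)" by simp
  then show "b * cell n x \<le> cell (Suc n) x" by (simp only: of_nat_less_iff)
  have "real (cell (Suc n) x) < x * real b ^ Suc n" by (rule cell_bounds(1)[OF assms])
  also have "\<dots> = real b * (x * real b ^ n)" by simp
  also have "\<dots> \<le> real b * (real (cell n x) + 1)"
    using cell_bounds(2)[OF assms, of n] by (intro mult_left_mono) auto
  also have "\<dots> = real (b * cell n x + b)" by (simp add: algebra_simps)
  finally show "cell (Suc n) x < b * cell n x + b" by (simp only: of_nat_less_iff)
qed

lemma cell_div: "0 < x \<Longrightarrow> cell n x = cell (Suc n) x div b"
  using cell_Suc_bounds[of x n] by (intro div_nat_eqI [symmetric]) (auto simp: mult.commute)

lemma digit_less: "0 < x \<Longrightarrow> digit x n < b"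
  using cell_Suc_bounds[of x n] by (simp add: digit_def)

text \<open>The cell at level n determines all coarser cells through integer division by b.\<close>

lemma cell_eq_imp_digit_eq:
  assumes "0 < x" "0 < y" "cell n x = cell n y" "i < n"
  shows "digit x i = digit y i"
proof -
  have "cell m x = cell m y" if "m \<le> n" for m
    using that
  proof (induction rule: inc_induct)
    case (step m)
    then show ?case using cell_div[OF assms(1), of m] cell_div[OF assms(2), of m] by simp
  qed (rule assms)
  then show ?thesis using assms(4) by (simp add: digit_def)
qed

lemma prefix_value_digit:
  assumes "0 < x" "x \<le> 1"
  shows "prefix_value (digit x) n = cell n x"
proof (induction n)
  case 0
  have "cell 0 x = 0" using assms by (intro cell_eqI) auto
  then show ?case by simp
next
  case (Suc n)
  then show ?case using cell_Suc_bounds(1)[OF assms(1), of n] by (simp add: digit_def)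
qed

lemma is_expansion_digit:
  assumes "0 < x" "x \<le> 1"
  shows "is_expansion b (digit x) x"
proof -
  let ?f = "\<lambda>j. real (digit x j) / real b ^ Suc j"
  have sum: "sum ?f {..<n} = real (cell n x) / real b ^ n" for n
    using sum_digits_eq[of "digit x" n] prefix_value_digit[OF assms, of n] by simp
  have "(\<lambda>n. sum ?f {..<n} - x) \<longlonglongrightarrow> 0"
  proof (rule Lim_null_comparison)
    show "(\<lambda>n. real n ^ 0 / real b ^ n) \<longlonglongrightarrow> 0" by (rule tendsto_poly_div_b_pow)
    have "\<bar>real (cell n x) / real b ^ n - x\<bar> \<le> 1 / real b ^ n" for n
    proof -
      have "\<bar>real (cell n x) - x * real b ^ n\<bar> / real b ^ n \<le> 1 / real b ^ n"
        using cell_bounds[OF assms(1), of n] by (intro divide_right_mono) auto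
      moreover have "real (cell n x) / real b ^ n - x = (real (cell n x) - x * real b ^ n) / real b ^ n"
        using b2 by (simp add: field_simps)
      ultimately show ?thesis by (simp add: abs_divide)
    qed
    then show "\<forall>\<^sub>F n in sequentially. norm (sum ?f {..<n} - x) \<le> real n ^ 0 / real b ^ n"
      unfolding sum by simp
  qed
  then have s: "?f sums x" unfolding sums_def by (rule LIM_zero_cancel)
  have "infinite {j. digit x j \<noteq> 0}"
  proof
    \<comment> \<open>A terminating expansion would make x equal to the left end of one of its
      cells, which the strict lower bound excludes.\<close>
    assume "finite {j. digit x j \<noteq> 0}"
    then obtain N where N: "\<And>j. N \<le> j \<Longrightarrow> digit x j = 0"
      unfolding finite_nat_set_iff_bounded by (metis (mono_tags) mem_Collect_eq not_less)
    have "?f sums (sum ?f {..<N})"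
      by (rule sums_finite) (auto simp: N not_less)
    then have "x = real (cell N x) / real b ^ N" using s sums_unique2 sum by metis
    then have "x * real b ^ N = real (cell N x)"
      using b_pow_pos[of N] by (metis less_irrefl nonzero_eq_divide_eq)
    then show False using cell_bounds(1)[OF assms(1), of N] by simp
  qed
  then show ?thesis using s digit_less[OF assms(1)] by (simp add: is_expansion_def)
qed

section \<open>Poisson generic numbers through their digits, and the Borel class\<close>

lemma Poisson_generic_numbers_eq:
  "Poisson_generic_numbers b = {x. 0 < x \<and> x < 1 \<and> Poisson_generic b (digit x)}"
proof -
  have "0 < x" if "is_expansion b d x" for d x
    using is_expansion_bounds(1)[OF that, of 0] by simp
  moreover have "is_expansion b d x \<longleftrightarrow> d = digit x" if "0 < x" "x < 1" for d x
    using that is_expansion_unique is_expansion_digit by (metis less_imp_le)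
  ultimately show ?thesis
    unfolding Poisson_generic_numbers_def by (metis less_imp_le)
qed

text \<open>Late windows all read one constant word, so passing from \<lambda> = 1 to \<lambda> = 2
  changes the count of at most one word, while the limits for j = 0 differ.\<close>

lemma not_Poisson_generic_eventually_const:
  assumes "\<And>i. n \<le> i \<Longrightarrow> d i = c"
  shows "\<not> Poisson_generic b d"
proof
  assume P: "Poisson_generic b d"
  define dz where "dz k = Z_freq b 1 0 k d - Z_freq b 2 0 k d" for k
  have "dz \<longlonglongrightarrow> exp (- 1) - exp (- 2)"
    unfolding dz_def
    using P[unfolded Poisson_generic_def lambda_Poisson_generic_def, rule_format, of 1 0]
      P[unfolded Poisson_generic_def lambda_Poisson_generic_def, rule_format, of 2 0]
    by (intro tendsto_diff) auto
  moreover have "dz \<longlonglongrightarrow> 0"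
  proof (rule Lim_null_comparison)
    show "(\<lambda>k. real k ^ 0 / real b ^ k) \<longlonglongrightarrow> 0" by (rule tendsto_poly_div_b_pow)
    show "\<forall>\<^sub>F k in sequentially. norm (dz k) \<le> real k ^ 0 / real b ^ k"
      using eventually_ge_at_top[of n]
    proof eventually_elim
      case (elim k)
      let ?u = "map d [0..<b ^ k + k]"
      let ?v = "map d [b ^ k + k..<2 * b ^ k + k]"
      let ?P = "{p. length ?u < p + k \<and> p + k \<le> length ?u + length ?v}"
      have uv: "map d [0..<2 * b ^ k + k] = ?u @ ?v"
        using upt_add_eq_append[of 0 "b ^ k + k" "b ^ k"]
        by (simp add: ac_simps mult_2 flip: map_append)
      have "(\<lambda>p. take k (drop p (?u @ ?v))) ` ?P \<subseteq> {replicate k c}"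
      proof
        fix w assume "w \<in> (\<lambda>p. take k (drop p (?u @ ?v))) ` ?P"
        then obtain p where p: "b ^ k < p" "p \<le> 2 * b ^ k" "w = take k (drop p (?u @ ?v))" by auto
        have "w = replicate k c"
          unfolding p(3) uv[symmetric]
        proof (rule nth_equalityI)
          fix t assume t: "t < length (take k (drop p (map d [0..<2 * b ^ k + k])))"
          \<comment> \<open>New windows start after \<open>b ^ k\<close>, which exceeds
            \<open>k \<ge> n\<close>, so they lie in the constant part.\<close>
          have "n \<le> p + t" using elim p(1) less_b_pow[of k] by linarith
          then show "take k (drop p (map d [0..<2 * b ^ k + k])) ! t = replicate k c ! t"
            using t assms p by simp
        qed (use p in simp)
        then show "w \<in> {replicate k c}" by simp
      qed
      then have "card ((\<lambda>p. take k (drop p (?u @ ?v))) ` ?P) \<le> 1"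
        using card_mono[of "{replicate k c}"] by fastforce
      then have "real (card ((\<lambda>p. take k (drop p (?u @ ?v))) ` ?P)) / real b ^ k \<le> 1 / real b ^ k"
        by (intro divide_right_mono) auto
      with fraction_diff_append[of k 0 ?u ?v]
      have "\<bar>fraction k 0 ?u - fraction k 0 (?u @ ?v)\<bar> \<le> 1 / real b ^ k" by linarith
      moreover have "nat \<lfloor>1 * real b ^ k\<rfloor> = b ^ k" "nat \<lfloor>2 * real b ^ k\<rfloor> = 2 * b ^ k"
        using floor_of_nat[of "b ^ k", where 'a = real] floor_of_nat[of "2 * b ^ k", where 'a = real]
        by (simp_all add: nat_mult_distrib nat_power_eq)
      ultimately show ?case
        unfolding dz_def uv[symmetric]
        using Z_freq_eq_fraction[of 1 0 k d] Z_freq_eq_fraction[of 2 0 k d] by simp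
    qed
  qed
  ultimately have "exp (- 1) - exp (- 2) = (0::real)" by (rule LIMSEQ_unique)
  then show False by simp
qed

text \<open>A b-adic rational is the right end of its cells from level n on, so its nonterminating
  expansion ends in digits b - 1.\<close>

lemma Poisson_generic_not_b_adic:
  assumes "0 < x" "Poisson_generic b (digit x)"
  shows "x \<noteq> real m / real b ^ n"
proof
  assume x: "x = real m / real b ^ n"
  have c: "cell k x + 1 = m * b ^ (k - n)" if "n \<le> k" for k
  proof -
    have xk: "x * real b ^ k = real (m * b ^ (k - n))"
      using le_Suc_ex[OF that] b2 by (auto simp: x power_add)
    show ?thesis
      using cell_bounds[OF assms(1), of k] unfolding xk by linarith
  qed
  have "digit x k = b - 1" if "n \<le> k" for k
  proof -
    have "Suc k - n = Suc (k - n)" using that by simp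
    then have "cell (Suc k) x + 1 = b * (cell k x + 1)"
      using c[of k] c[of "Suc k"] that by (simp add: ac_simps)
    then show ?thesis by (simp add: digit_def)
  qed
  then show False using not_Poisson_generic_eventually_const assms(2) by blast
qed

text \<open>Closed cells stand in for half-open ones; the points thereby added are end points, hence
  b-adic rationals.\<close>

lemma closedin_cells:
  assumes "finite S"
  shows "closedin (top_of_set {0..<1}) {x \<in> {0..<1}. \<exists>c\<in>S. real c \<le> x * real b ^ n \<and> x * real b ^ n \<le> real c + 1}"
proof -
  have "{x \<in> {0..<1::real}. \<exists>c\<in>S. real c \<le> x * real b ^ n \<and> x * real b ^ n \<le> real c + 1} =
      {0..<1} \<inter> (\<Union>c\<in>S. {real c / real b ^ n..(real c + 1) / real b ^ n})"
    using b_pow_pos[of n] by (auto simp: field_simps)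
  moreover have "closed (\<Union>c\<in>S. {real c / real b ^ n..(real c + 1) / real b ^ n})"
    using assms by (intro closed_UN) auto
  ultimately show ?thesis by (simp only: closedin_closed_Int)
qed

text \<open>Serves to remove the b-adic rationals one at a time.\<close>

lemma Sigma0_remove_point: "Sigma0 (top_of_set {0..<1}) 2 ({0..<1} - {r :: real})"
proof -
  have "{0..<1} - {r} = (\<Union>i. {0..<1} \<inter> (- ball r (1 / real (Suc i))))"
  proof (intro set_eqI iffI)
    fix x assume x: "x \<in> {0..<1} - {r}"
    then have "0 < dist r x" by auto
    then obtain i where "1 / real (Suc i) < dist r x" by (rule nat_approx_posE)
    then show "x \<in> (\<Union>i. {0..<1} \<inter> (- ball r (1 / real (Suc i))))" 
      using x by (intro UN_I[of i]) auto
  qed auto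
  moreover have "Pi0 (top_of_set {0..<1}) 1 ({0..<1} \<inter> (- ball r (1 / real (Suc i))))" for i
    by (rule Pi0_closed) (auto intro: closedin_closed_Int)
  ultimately show ?thesis
    using Sigma0_Union[of "top_of_set {0..<1::real}" 1] by (metis Suc_1)
qed

text \<open>Genericity says that for all rational data some K exists such that every
  \<open>k \<ge> K\<close> satisfies a condition on finitely many digits. Away from the b-adic
  rationals this condition is the closed set C, and each of these rationals is removed by a further
  factor of the intersection.\<close>

theorem Pi0_Poisson_generic_numbers:
  "Pi0 (top_of_set {0..<1}) 3 (Poisson_generic_numbers b)"
proof -
  define rat where "rat m q = real (Suc m) / real (Suc q)" for m q
  define len where "len m q k = nat \<lfloor>rat m q * real b ^ k\<rfloor> + k" for m q k
  define ok where "ok m q j e k x \<longleftrightarrow>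
    \<bar>Z_freq b (rat m q) j k (digit x) - poisson j (rat m q)\<bar> \<le> 1 / real (Suc e)" for m q j e k x
  define S where "S m q j e k = cell (len m q k) ` {x. 0 < x \<and> x < 1 \<and> ok m q j e k x}" for m q j e k
  define C where "C m q j e k = {x \<in> {0..<1}. \<exists>c\<in>S m q j e k.
    real c \<le> x * real b ^ len m q k \<and> x * real b ^ len m q k \<le> real c + 1}" for m q j e k
  define F where "F = case_sum (\<lambda>(m, q, j, e). \<Union>K. \<Inter>k. C m q j e (K + k))
    (\<lambda>(m, n). {0..<1} - {real m / real b ^ n})"
  have closed: "closedin (top_of_set {0..<1}) (C m q j e k)" for m q j e k
    unfolding C_def
  proof (rule closedin_cells)
    have "S m q j e k \<subseteq> {..<b ^ len m q k}"
    proof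
      fix c assume "c \<in> S m q j e k"
      then obtain x where x: "0 < x" "x < 1" "c = cell (len m q k) x" by (auto simp: S_def)
      have "real c < x * real b ^ len m q k" using cell_bounds(1)[OF x(1)] x(3) by simp
      also have "\<dots> < 1 * real b ^ len m q k" using x b_pow_pos by (intro mult_strict_right_mono) auto
      finally show "c \<in> {..<b ^ len m q k}" by (simp flip: of_nat_power)
    qed
    then show "finite (S m q j e k)" using finite_subset by blast
  qed
  have Sigma: "Sigma0 (top_of_set {0..<1}) 2 (F i)" for i
  proof (cases i)
    case (Inl t)
    obtain m q j e where t: "t = (m, q, j, e)" by (cases t)
    have "Pi0 (top_of_set {0..<1}) 1 (\<Inter>k. C m q j e (K + k))" for K
      by (intro Pi0_closed closedin_Inter) (use closed in auto)
    from Sigma0_Union[OF this] show ?thesis unfolding F_def Inl t by (simp only: sum.case prod.case Suc_1)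
  next
    case (Inr t)
    then show ?thesis unfolding F_def by (cases t) (simp add: Sigma0_remove_point)
  qed
  \<comment> \<open>Such an x is no end point of a cell, so closed and half-open cells agree at x,
    and the condition depends only on the cell of x.\<close>
  have C_iff: "x \<in> C m q j e k \<longleftrightarrow> ok m q j e k x"
    if x: "0 < x" "x < 1" "\<And>c n. x \<noteq> real c / real b ^ n" for x m q j e k
  proof -
    define n where "n = len m q k"
    have nonint: "x * real b ^ n \<noteq> real c" for c
      using x(3)[of c n] b2 by (simp add: field_simps)
    have "x \<in> C m q j e k \<longleftrightarrow> cell n x \<in> S m q j e k"
    proof
      assume "x \<in> C m q j e k"
      then obtain c where c: "c \<in> S m q j e k" "real c \<le> x * real b ^ n" "x * real b ^ n \<le> real c + 1"
        by (auto simp: C_def n_def)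
      then have "cell n x = c" using nonint[of c] by (intro cell_eqI) auto
      then show "cell n x \<in> S m q j e k" using c by simp
    next
      assume "cell n x \<in> S m q j e k"
      then show "x \<in> C m q j e k"
        using x(1,2) cell_bounds[OF x(1), of n] by (auto simp: C_def n_def intro: less_imp_le)
    qed
    also have "\<dots> \<longleftrightarrow> ok m q j e k x"
    proof
      assume "cell n x \<in> S m q j e k"
      then obtain y where y: "0 < y" "ok m q j e k y" "cell n x = cell n y"
        by (auto simp: S_def n_def)
      have "map (digit x) [0..<n] = map (digit y) [0..<n]"
        using cell_eq_imp_digit_eq[OF x(1) y(1,3)] by simp
      moreover have "Z_freq b (rat m q) j k d = fraction k j (map d [0..<n])" for d
        unfolding n_def len_def by (rule Z_freq_eq_fraction) (simp add: rat_def)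
      ultimately have "Z_freq b (rat m q) j k (digit x) = Z_freq b (rat m q) j k (digit y)"
        by (simp only:)
      then show "ok m q j e k x" using y(2) unfolding ok_def by (simp only:)
    qed (use x in \<open>auto simp: S_def n_def\<close>)
    finally show ?thesis .
  qed
  have "Poisson_generic_numbers b = (\<Inter>i. F i)"
  proof (rule set_eqI)
    fix x :: real
    have generic: "Poisson_generic b (digit x) \<longleftrightarrow> (\<forall>m q j e. \<exists>K. \<forall>k. ok m q j e (K + k) x)"
      unfolding Poisson_generic_iff ok_def rat_def eventually_sequentially
      by (metis le_add1 le_Suc_ex)
    have "x \<in> Poisson_generic_numbers b \<longleftrightarrow> 0 < x \<and> x < 1 \<and>
        (\<forall>m q j e. \<exists>K. \<forall>k. ok m q j e (K + k) x) \<and> (\<forall>c n. x \<noteq> real c / real b ^ n)"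
      unfolding Poisson_generic_numbers_eq using generic Poisson_generic_not_b_adic by blast
    also have "\<dots> \<longleftrightarrow> 0 < x \<and> x < 1 \<and>
        (\<forall>m q j e. \<exists>K. \<forall>k. x \<in> C m q j e (K + k)) \<and> (\<forall>c n. x \<noteq> real c / real b ^ n)"
      using C_iff by blast
    also have "\<dots> \<longleftrightarrow> 0 \<le> x \<and> x < 1 \<and>
        (\<forall>m q j e. \<exists>K. \<forall>k. x \<in> C m q j e (K + k)) \<and> (\<forall>c n. x \<noteq> real c / real b ^ n)"
    proof -
      \<comment> \<open>The point 0 is itself b-adic, so no separate factor is required to exclude
        it.\<close>
      have "x \<noteq> 0" if "\<forall>c n. x \<noteq> real c / real b ^ n" using that[rule_format, of 0 0] by simp
      then show ?thesis by force
    qed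
    also have "\<dots> \<longleftrightarrow> (\<forall>i. x \<in> F i)"
      by (auto simp: F_def split_sum_all)
    finally show "x \<in> Poisson_generic_numbers b \<longleftrightarrow> x \<in> (\<Inter>i. F i)" by simp
  qed
  moreover have "Pi0 (top_of_set {0..<1}) 3 (\<Inter>i. F i)"
    using Pi0_Inter_countable[OF Sigma] by (simp add: eval_nat_numeral)
  ultimately show ?thesis by simp
qed

end

section \<open>Completeness\<close>

lemma separable_metrizable_imp_second_countable:
  assumes "metrizable_space X" "separable_space X"
  shows "second_countable X"
proof -
  obtain M d where "Metric_space M d" and X: "X = Metric_space.mtopology M d"
    using assms(1) by (auto simp: metrizable_space_def)
  then interpret Metric_space M d by simp
  obtain C where C: "countable C" "C \<subseteq> M" "mtopology closure_of C = M"
    using assms(2) by (auto simp: separable_space_def X)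
  define B where "B = (\<lambda>(c, n). mball c (1 / real (Suc n))) ` (C \<times> UNIV)"
  have "\<exists>V\<in>B. x \<in> V \<and> V \<subseteq> U" if U: "openin mtopology U" "x \<in> U" for U x
  proof -
    obtain r where r: "0 < r" "mball x r \<subseteq> U" and "x \<in> M"
      using U by (meson openin_mtopology subsetD)
    obtain n where n: "1 / real (Suc n) < r / 2" using nat_approx_posE[of "r / 2"] r by auto
    have "x \<in> mtopology closure_of C" using C \<open>x \<in> M\<close> by simp
    moreover have "0 < 1 / real (Suc n)" by simp
    ultimately obtain c where c: "c \<in> C" "c \<in> mball x (1 / real (Suc n))"
      unfolding metric_closure_of by blast
    have "mball c (1 / real (Suc n)) \<subseteq> mball x r"
    proof
      fix y assume y: "y \<in> mball c (1 / real (Suc n))"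
      then have "d x y \<le> d x c + d c y" using c \<open>x \<in> M\<close> by (auto intro: triangle)
      then show "y \<in> mball x r" using y c n by auto
    qed
    moreover have "x \<in> mball c (1 / real (Suc n))" using c by (auto simp: commute)
    moreover have "mball c (1 / real (Suc n)) \<in> B" using c by (auto simp: B_def)
    ultimately show ?thesis using r by blast
  qed
  moreover have "countable B" using C by (auto simp: B_def)
  moreover have "openin mtopology V" if "V \<in> B" for V using that by (auto simp: B_def)
  ultimately show ?thesis unfolding second_countable_def X by blast
qed

text \<open>Zero-dimensionality puts a clopen set inside U around each point. Choosing one clopen
  set for each basic set that fits into such a set reduces them to countably many.\<close>

lemma open_Union_clopen:
  assumes "second_countable X" "X dim_le 0" "openin X U"
  shows "\<exists>D :: nat \<Rightarrow> 'a set. (\<forall>n. openin X (D n) \<and> closedin X (D n)) \<and> U = (\<Union>n. D n)"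
proof -
  obtain B where B: "countable B" "\<And>U x. openin X U \<Longrightarrow> x \<in> U \<Longrightarrow> \<exists>V\<in>B. x \<in> V \<and> V \<subseteq> U"
    using assms(1) unfolding second_countable_def by metis
  define good where "good V E \<longleftrightarrow> V \<subseteq> E \<and> E \<subseteq> U \<and> openin X E \<and> closedin X E" for V E
  \<comment> \<open>The empty set makes the family nonempty, so that it can be enumerated even if U
    is empty.\<close>
  define F where "F = insert {} ((\<lambda>V. SOME E. good V E) ` {V \<in> B. \<exists>E. good V E})"
  have F: "E \<subseteq> U \<and> openin X E \<and> closedin X E" if E: "E \<in> F" for E
  proof (cases "E = {}")
    case False
    then obtain V where "\<exists>E. good V E" "E = (SOME E. good V E)" 
      using E unfolding F_def by blast
    then have "good V E" using someI_ex by metis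
    then show ?thesis by (simp add: good_def)
  qed simp
  have "x \<in> \<Union>F" if x: "x \<in> U" for x
  proof -
    obtain E where E: "openin X E" "closedin X E" "x \<in> E" "E \<subseteq> U"
      using assms(2,3) x unfolding dimension_le_0_neighbourhood_base_of_clopen neighbourhood_base_of
      by (metis subsetD)
    obtain V where V: "V \<in> B" "x \<in> V" "V \<subseteq> E" using B(2)[OF E(1,3)] by blast
    then have ex: "\<exists>E. good V E" using E by (auto simp: good_def)
    then have "V \<subseteq> (SOME E. good V E)" using someI_ex[OF ex] by (simp add: good_def)
    then show ?thesis using V ex by (auto simp: F_def)
  qed
  then have U: "\<Union>F = U" using F by blast
  have "countable F" "F \<noteq> {}" using B(1) by (auto simp: F_def)
  then have "range (from_nat_into F) = F" by (rule range_from_nat_into[rotated])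
  then show ?thesis using F U by (intro exI[of _ "from_nat_into F"]) (metis from_nat_into \<open>F \<noteq> {}\<close>)
qed

lemma Pi0_3_closed:
  assumes "Pi0 X 3 A"
  shows "\<exists>C. (\<forall>i j. closedin X (C i j)) \<and> A = (\<Inter>i::nat. \<Union>j::nat. C i j)"
proof -
  \<comment> \<open>Rules out that a set at level 1 arises by \<open>Pi0_Inter\<close> from level
    0.\<close>
  have no0: "\<not> Sigma0 X 0 S" for S by (auto elim: Sigma0.cases)
  have closed: "closedin X S" if "Pi0 X 1 S" for S
    using that by (cases rule: Pi0.cases) (use no0 in auto)
  have "\<exists>F. (\<forall>j. closedin X (F j)) \<and> S = (\<Union>j::nat. F j)" if "Sigma0 X 2 S" for S
    using that
  proof (cases rule: Sigma0.cases)
    case (Sigma0_Union n F)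
    then have "n = 1" by simp
    then have "closedin X (F j)" for j using Sigma0_Union closed by simp
    then show ?thesis using Sigma0_Union(2) by (intro exI[of _ F]) simp
  qed simp
  note Sigma_2 = this
  obtain S where S: "\<And>i. Sigma0 X 2 (S i)" "A = (\<Inter>i::nat. S i)"
    using assms by (cases rule: Pi0.cases) (auto simp: numeral_3_eq_3 numeral_2_eq_2)
  have "\<forall>i. \<exists>F. (\<forall>j. closedin X (F j)) \<and> S i = (\<Union>j::nat. F j)"
    using Sigma_2[OF S(1)] by blast
  from choice[OF this] obtain C where "\<forall>i. (\<forall>j. closedin X (C i j)) \<and> S i = (\<Union>j::nat. C i j)" ..
  then show ?thesis using S(2) by (intro exI[of _ C]) simp
qed

section \<open>Coding the normal form by sequences tending to infinity\<close>

text \<open>The candidate \<open>j\<close> for a row without events is given up as soon as an event in row \<open>j\<close>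
  has been seen.\<close>

primrec pointer :: "(nat \<Rightarrow> nat \<Rightarrow> bool) \<Rightarrow> nat \<Rightarrow> nat" where
  "pointer E 0 = 0"
| "pointer E (Suc t) = (if \<exists>n\<le>t. E (pointer E t) n then Suc (pointer E t) else pointer E t)"

lemma pointer_le: "pointer E t \<le> t"
  by (induction t) auto

lemma pointer_mono: "s \<le> t \<Longrightarrow> pointer E s \<le> pointer E t"
  by (rule lift_Suc_mono_le) auto

text \<open>Up to time T + 1 the pointer has inspected only rows and columns up to T.\<close>

lemma pointer_cong:
  assumes "\<And>j n. j \<le> T \<Longrightarrow> n \<le> T \<Longrightarrow> E j n \<longleftrightarrow> E' j n" "t \<le> Suc T"
  shows "pointer E t = pointer E' t"
  using assms(2)
proof (induction t)
  case (Suc t)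
  then have "pointer E t = pointer E' t" "pointer E' t \<le> T" using pointer_le[of E' t] by auto
  then show ?case using assms(1) Suc.prems by auto
qed simp

text \<open>A pointer that rests on a row forever has seen no event there. Conversely it never
  passes an event-free row, and each move increases it.\<close>

lemma pointer_stabilizes_iff:
  "finite {t. pointer E (Suc t) \<noteq> pointer E t} \<longleftrightarrow> (\<exists>j. \<forall>n. \<not> E j n)" (is "finite ?S \<longleftrightarrow> _")
proof
  assume "finite ?S"
  then obtain N where N: "\<And>t. N \<le> t \<Longrightarrow> pointer E (Suc t) = pointer E t"
    unfolding finite_nat_set_iff_bounded by (metis (mono_tags, lifting) mem_Collect_eq not_less)
  have const: "pointer E t = pointer E N" if "N \<le> t" for t
    using that by (induction rule: dec_induct) (use N in \<open>auto simp del: pointer.simps\<close>)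
  have "\<not> E (pointer E N) n" for n
  proof -
    have "pointer E (Suc (max N n)) = pointer E (max N n)" by (rule N) simp
    then have "\<not> (\<exists>m\<le>max N n. E (pointer E (max N n)) m)" by (auto split: if_splits)
    then show ?thesis using const[of "max N n"] by auto
  qed
  then show "\<exists>j. \<forall>n. \<not> E j n" by blast
next
  assume "\<exists>j. \<forall>n. \<not> E j n"
  then obtain j where j: "\<And>n. \<not> E j n" by blast
  have "pointer E t \<le> j" for t
  proof (induction t)
    case (Suc t)
    then show ?case using j by (cases "pointer E t = j") auto
  qed simp
  then have "pointer E ` ?S \<subseteq> {..j}" by auto
  moreover have "inj_on (pointer E) ?S"
  proof (rule linorder_inj_onI)
    fix s t assume st: "s < t" "s \<in> ?S" "t \<in> ?S"
    then have "pointer E (Suc s) = Suc (pointer E s)" by (auto split: if_splits)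
    then show "pointer E s \<noteq> pointer E t" using pointer_mono[of "Suc s" t E] st(1) by simp
  qed auto
  ultimately show "finite ?S" using finite_imageD finite_subset by blast
qed

text \<open>Time s codes a pair (i, t). A move of the i-th pointer emits i, and otherwise the
  harmless large value s is emitted, so i recurs infinitely often exactly if its pointer never
  settles.\<close>

definition interleave :: "(nat \<Rightarrow> nat \<Rightarrow> nat \<Rightarrow> bool) \<Rightarrow> nat \<Rightarrow> nat" where
  "interleave E s = (case prod_decode s of (i, t) \<Rightarrow>
     if pointer (E i) (Suc t) \<noteq> pointer (E i) t then i else s)"

lemma interleave_cong:
  assumes "\<And>i j n. i \<le> s \<Longrightarrow> j \<le> s \<Longrightarrow> n \<le> s \<Longrightarrow> E i j n \<longleftrightarrow> E' i j n"
  shows "interleave E s = interleave E' s"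
proof -
  obtain i t where it: "prod_decode s = (i, t)" by (cases "prod_decode s")
  then have "s = prod_encode (i, t)" by (metis prod_decode_inverse)
  then have "i \<le> s" "t \<le> s" using le_prod_encode_1 le_prod_encode_2 by auto
  then have "pointer (E i) u = pointer (E' i) u" if "u \<le> Suc t" for u
    using assms that by (intro pointer_cong[of s]) auto
  then show ?thesis by (simp only: interleave_def it prod.case order_refl le_SucI)
qed

lemma interleave_at_top:
  assumes "\<And>i. \<exists>j. \<forall>n. \<not> E i j n"
  shows "filterlim (interleave E) at_top sequentially"
  unfolding filterlim_at_top
proof
  fix c
  \<comment> \<open>A value below c is either the default at some s < c or a move of one of the
    finitely many pointers i < c, each moving finitely often.\<close>
  have "{s. \<not> c \<le> interleave E s} \<subseteq>
      {..<c} \<union> (\<Union>i<c. (\<lambda>t. prod_encode (i, t)) ` {t. pointer (E i) (Suc t) \<noteq> pointer (E i) t})"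
  proof
    fix s assume s: "s \<in> {s. \<not> c \<le> interleave E s}"
    obtain i t where it: "prod_decode s = (i, t)" by (cases "prod_decode s")
    then have "s = prod_encode (i, t)" by (metis prod_decode_inverse)
    then show "s \<in> {..<c} \<union> (\<Union>i<c. (\<lambda>t. prod_encode (i, t)) ` {t. pointer (E i) (Suc t) \<noteq> pointer (E i) t})"
      using s unfolding interleave_def it by (auto simp del: pointer.simps split: if_splits)
  qed
  moreover have "finite {t. pointer (E i) (Suc t) \<noteq> pointer (E i) t}" for i
    using assms by (simp only: pointer_stabilizes_iff)
  ultimately have "finite {s. \<not> c \<le> interleave E s}"
    by (elim finite_subset) (simp del: pointer.simps)
  then show "\<forall>\<^sub>F s in sequentially. c \<le> interleave E s"
    unfolding cofinite_eq_sequentially[symmetric] eventually_cofinite .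
qed

lemma interleave_infinite:
  assumes "\<not> (\<exists>j. \<forall>n. \<not> E i j n)"
  shows "infinite {s. interleave E s = i}"
proof -
  let ?T = "{t. pointer (E i) (Suc t) \<noteq> pointer (E i) t}"
  have "infinite ?T" using assms by (simp only: pointer_stabilizes_iff) simp
  moreover have "inj_on (\<lambda>t. prod_encode (i, t)) ?T" by (rule inj_onI) simp
  ultimately have "infinite ((\<lambda>t. prod_encode (i, t)) ` ?T)" using finite_imageD by blast
  moreover have "(\<lambda>t. prod_encode (i, t)) ` ?T \<subseteq> {s. interleave E s = i}"
    by (auto simp: interleave_def simp del: pointer.simps)
  ultimately show ?thesis using finite_subset by blast
qed

section \<open>The continuous reduction\<close>

context base
begin

lemma is_expansion_suminf:
  assumes "\<And>j. d j < b" "infinite {j. d j \<noteq> 0}"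
  shows "is_expansion b d (\<Sum>j. real (d j) / real b ^ Suc j)"
proof -
  have "summable (\<lambda>j. real (d j) / real b ^ Suc j)"
  proof (rule summable_comparison_test')
    show "summable (\<lambda>j. real j ^ 0 / real b ^ j)" by (rule summable_poly_div_b_pow)
    fix j
    have "real (d j) / real b ^ Suc j \<le> real b / real b ^ Suc j"
      using assms(1)[of j] by (intro divide_right_mono) auto
    also have "\<dots> = real j ^ 0 / real b ^ j" using b2 by simp
    finally show "norm (real (d j) / real b ^ Suc j) \<le> real j ^ 0 / real b ^ j" by simp
  qed
  then show ?thesis using assms by (simp add: is_expansion_def summable_sums)
qed

text \<open>Both points lie in the same cell of level n.\<close>

lemma is_expansion_prefix_dist:
  assumes "is_expansion b d x" "is_expansion b d' x'" "\<And>j. j < n \<Longrightarrow> d j = d' j"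
  shows "\<bar>x - x'\<bar> \<le> 1 / real b ^ n"
proof -
  have "m \<le> n \<Longrightarrow> prefix_value d m = prefix_value d' m" for m
    by (induction m) (use assms(3) in auto)
  then have "\<bar>x * real b ^ n - x' * real b ^ n\<bar> \<le> 1"
    using is_expansion_bounds[OF assms(1), of n] is_expansion_bounds[OF assms(2), of n] by force
  then have "\<bar>x - x'\<bar> * real b ^ n \<le> 1" by (simp add: abs_mult flip: left_diff_distrib)
  then show ?thesis using b_pow_pos[of n] by (simp add: pos_le_divide_eq)
qed

text \<open>The complement of each closed \<open>C i j\<close> is a union of clopen pieces
  \<open>D i j n\<close>. An event is membership in a piece, so an event-free row j means
  \<open>z \<in> C i j\<close>, and z lies in A exactly if \<open>\<alpha> z\<close> tends to
  infinity.\<close>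

theorem Pi0_hard_Poisson_generic_numbers:
  fixes Z :: "'z topology"
  assumes "Polish_space Z" "Z dim_le 0" "Pi0 Z 3 A"
  shows "continuously_reducible Z A (top_of_set {0..<1}) (Poisson_generic_numbers b)"
proof -
  have sc: "second_countable Z"
    using assms(1) by (simp add: Polish_space_def completely_metrizable_imp_metrizable_space
        separable_metrizable_imp_second_countable)
  from Pi0_3_closed[OF assms(3)] obtain C
    where C': "(\<forall>i j. closedin Z (C i j)) \<and> A = (\<Inter>i::nat. \<Union>j::nat. C i j)" ..
  have C: "closedin Z (C i j)" "A = (\<Inter>i. \<Union>j. C i j)" for i j
    using C' by auto
  have "\<exists>D :: nat \<Rightarrow> 'z set. (\<forall>n. openin Z (D n) \<and> closedin Z (D n)) \<and> topspace Z - C i j = (\<Union>n. D n)" for i j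
    using C(1) by (intro open_Union_clopen sc assms(2)) auto
  then have "\<forall>p. \<exists>D :: nat \<Rightarrow> 'z set. (\<forall>n. openin Z (D n) \<and> closedin Z (D n)) \<and>
      topspace Z - C (fst p) (snd p) = (\<Union>n. D n)"
    by blast
  from choice[OF this] obtain D' where D': "\<forall>p. (\<forall>n. openin Z (D' p n) \<and> closedin Z (D' p n)) \<and>
      topspace Z - C (fst p) (snd p) = (\<Union>n::nat. D' p n)" ..
  define D where "D i j = D' (i, j)" for i j
  have D: "openin Z (D i j n)" "closedin Z (D i j n)" "topspace Z - C i j = (\<Union>n. D i j n)" for i j n
    using D'[rule_format, of "(i, j)"] by (auto simp: D_def)
  define \<alpha> where "\<alpha> z = interleave (\<lambda>i j n. z \<in> D i j n)" for z
  have A_iff: "z \<in> A \<longleftrightarrow> (\<forall>i. \<exists>j. \<forall>n. z \<notin> D i j n)" if "z \<in> topspace Z" for z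
  proof -
    have "z \<in> C i j \<longleftrightarrow> (\<forall>n. z \<notin> D i j n)" for i j
      using that D(3)[of i j] by (metis DiffD2 DiffI UN_E UN_I UNIV_I)
    then show ?thesis unfolding C(2) by simp
  qed
  have loc: "\<exists>U. openin Z U \<and> z \<in> U \<and> (\<forall>z'\<in>U. \<forall>s<m. \<alpha> z' s = \<alpha> z s)" if z: "z \<in> topspace Z" for z m
  proof -
    \<comment> \<open>Membership and non-membership in a clopen piece are both open conditions, and
      finitely many of them fix \<open>\<alpha> z\<close> below m.\<close>
    define V where "V = (\<lambda>(i, j, n). if z \<in> D i j n then D i j n else topspace Z - D i j n)"
    define U where "U = (\<Inter>t\<in>{..m} \<times> {..m} \<times> {..m}. V t)"
    have "openin Z U"
      unfolding U_def by (rule openin_INT2) (use D(1) D(2)[unfolded closedin_def] in \<open>auto simp: V_def\<close>)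
    moreover have "z \<in> U" using z by (auto simp: U_def V_def)
    moreover have "\<alpha> z' s = \<alpha> z s" if "z' \<in> U" "s < m" for z' s
      unfolding \<alpha>_def
    proof (rule interleave_cong)
      fix i j n assume "i \<le> s" "j \<le> s" "n \<le> s"
      then have "(i, j, n) \<in> {..m} \<times> {..m} \<times> {..m}" using \<open>s < m\<close> by auto
      then have "z' \<in> V (i, j, n)" using that unfolding U_def by blast
      then show "z' \<in> D i j n \<longleftrightarrow> z \<in> D i j n" by (auto simp: V_def split: if_splits)
    qed
    ultimately show ?thesis by blast
  qed
  obtain x where x: "\<And>i. x i < b" "Poisson_generic b x" using Poisson_generic_exists by blast
  define y where "y z = erase x (\<alpha> z)" for z
  define f where "f z = (\<Sum>j. real (y z j) / real b ^ Suc j)" for z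
  have exp: "is_expansion b (y z) (f z)" for z
    unfolding f_def y_def by (rule is_expansion_suminf) (use erase_less x infinite_erase in auto)
  have range: "0 < f z" "f z < 1" for z
  proof -
    show "0 < f z" using is_expansion_bounds(1)[OF exp, of z 0] by simp
    \<comment> \<open>The leading digit 0 keeps the value at most 1 / b.\<close>
    have "f z * real b \<le> 1"
      using is_expansion_bounds(2)[OF exp, of z 1] by (simp add: y_def erase_0)
    moreover have "f z * 1 < f z * real b" using \<open>0 < f z\<close> b2 by (intro mult_strict_left_mono) auto
    ultimately show "f z < 1" by simp
  qed
  have "continuous_map Z euclidean f"
    unfolding continuous_map_def
  proof (intro conjI allI impI)
    fix V :: "real set" assume "openin euclidean V"
    then have V: "open V" by simp
    show "openin Z {z \<in> topspace Z. f z \<in> V}"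
    proof (subst openin_subopen, intro ballI)
      fix z assume z: "z \<in> {z \<in> topspace Z. f z \<in> V}"
      then obtain e where e: "0 < e" "ball (f z) e \<subseteq> V" 
        using openE[OF V, of "f z"] by auto
      have "\<forall>\<^sub>F m in sequentially. real m ^ 0 / real b ^ m < e"
        using tendsto_poly_div_b_pow[of 0] e(1) by (rule order_tendstoD)
      then obtain m where m: "1 / real b ^ m < e" by (auto simp: eventually_sequentially)
      obtain U where U: "openin Z U" "z \<in> U" "\<And>z' s. z' \<in> U \<Longrightarrow> s < m \<Longrightarrow> \<alpha> z' s = \<alpha> z s"
        using loc[of z m] z by blast
      have "f z' \<in> V" if "z' \<in> U" for z'
      proof -
        have "y z j = y z' j" if "j < m" for j
          unfolding y_def using U(3)[OF \<open>z' \<in> U\<close>] that by (intro erase_cong) simp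
        then have "\<bar>f z - f z'\<bar> \<le> 1 / real b ^ m" 
          by (rule is_expansion_prefix_dist[OF exp exp])
        then show ?thesis using e(2) m by (auto simp: dist_real_def subset_iff)
      qed
      then show "\<exists>U. openin Z U \<and> z \<in> U \<and> U \<subseteq> {z \<in> topspace Z. f z \<in> V}"
        using U(1,2) openin_subset[OF U(1)] by blast
    qed
  qed auto
  then have "continuous_map Z (top_of_set {0..<1}) f"
    using range less_imp_le[OF range(1)] by (auto simp: continuous_map_in_subtopology)
  moreover have "z \<in> A \<longleftrightarrow> f z \<in> Poisson_generic_numbers b" if z: "z \<in> topspace Z" for z
  proof -
    have "f z \<in> Poisson_generic_numbers b \<longleftrightarrow> Poisson_generic b (y z)"
      using range[of z] is_expansion_unique[OF exp, of z] by (simp add: Poisson_generic_numbers_eq)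
    also have "\<dots> \<longleftrightarrow> z \<in> A"
    proof
      assume "z \<in> A"
      then show "Poisson_generic b (y z)"
        unfolding y_def \<alpha>_def using A_iff[OF z]
        by (intro Poisson_generic_erase x interleave_at_top) auto
    next
      assume P: "Poisson_generic b (y z)"
      show "z \<in> A"
      proof (rule ccontr)
        assume "z \<notin> A"
        then obtain i where "\<not> (\<exists>j. \<forall>n. z \<notin> D i j n)" using A_iff[OF z] by blast
        then have "infinite {s. \<alpha> z s = i}" unfolding \<alpha>_def by (rule interleave_infinite)
        then show False using P not_Poisson_generic_erase unfolding y_def by blast
      qed
    qed
    finally show ?thesis by blast
  qed
  ultimately show ?thesis unfolding continuously_reducible_def by blast
qed

end

theorem theorem1:
  fixes b :: nat
  assumes "b \<ge> 2"
  shows "Pi0_complete TYPE('z) 3 (top_of_set {0..<1}) (Poisson_generic_numbers b)"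
proof -
  interpret base b by unfold_locales (rule assms)
  show ?thesis
    unfolding Pi0_complete_def
    using Pi0_Poisson_generic_numbers Pi0_hard_Poisson_generic_numbers by blast
qed

end
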